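(* Let $C_n$ be a generic $n$-rosette. Then: (i) the number of smooth branches of $\mathrm{CSS}(C_n)$ is equal to $n$; (ii) exactly one smooth branch of $\mathrm{CSS}(C_n)$ has an odd number of cusps; (iii) $n-1$ smooth branches of $\mathrm{CSS}(C_n)$ have integer rotation number and one branch has half-integer rotation number; (iv) exactly $\lfloor n/2\rfloor$ smooth branches of $\mathrm{CSS}(C_n)$ have asymptotes; (v) the number of cusp singularities of a smooth branch of $\mathrm{CSS}(C_n)$ which does not have an asymptote is not smaller than the number of cusp singularities of the smooth branch of the Wigner caustic of $C_n$ generated by the same family of parallel pairs.
   Context: An $n$-rosette is a closed regular curve with nowhere vanishing curvature and rotation number $n$. Generic: the parameterization $f:S^1\to\mathbb{R}^2$ is regular with only transversal self-crossings and satisfies non-degeneracy conditions on parallel pairs (e.g. if $\kappa'(s_1)\kappa^2(s_2)=\kappa^2(s_1)\kappa'(s_2)$ at a parallel pair then $\kappa''(s_1)\kappa^3(s_2)\ne\kappa^3(s_1)\kappa''(s_2)$, where sums $\kappa(s_1)-\operatorname{sgn}\langle f'(s_1),f'(s_2)\rangle\kappa(s_2)$ vanish the previous equality fails, no two distinct parallel pairs with vanishing such sums share a chord, and self-intersections of the CSS are transversal). Distinct points form a parallel pair if their tangent lines are parallel. $\mathrm{CSS}(C_n)$ is the envelope of lines through parallel pairs; it consists of double tangents and curves that are images of continuous families of parallel pairs $(a,b)$ under $\pi_{\mathrm{CSS}}(a,b)=\frac{\kappa(a)a+\kappa(b)b}{\kappa(a)+\kappa(b)}$ (curvatures w.r.t.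 local arc-length parameterizations oriented oppositely at $a$ and $b$); where $\kappa(a)+\kappa(b)=0$ the line through $a,b$ is an asymptote. Maximal such curves are smooth semi-branches, those sharing an asymptote are joined, giving smooth branches. The Wigner caustic is $\{(a+b)/2: a,b \text{ parallel pair}\}$; its smooth branches are images of the same families of parallel pairs under $(a,b)\mapsto (a+b)/2$. The rotation number of a curve with cusps is the rotation number of its continuous unit normal field (an integer or half-integer). *)

theory Defs
  imports "HOL-Complex_Analysis.Complex_Analysis"
begin

text \<open>Plane = complex numbers.  The parameter circle S^1 is R/Z: a closed curve is a
  1-periodic map f :: real => complex; the point of S^1 represented by t is ecirc t.\<close>

definition ecirc :: "real \<Rightarrow> complex" where
  "ecirc t = cis (2 * pi * t)"

definition D :: "(real \<Rightarrow> 'a::real_normed_vector) \<Rightarrow> real \<Rightarrow> 'a" where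
  "D g = (\<lambda>t. vector_derivative g (at t))"

definition smooth_fun :: "(real \<Rightarrow> 'a::real_normed_vector) \<Rightarrow> bool" where
  "smooth_fun g \<longleftrightarrow> (\<forall>k t. ((D ^^ k) g has_vector_derivative (D ^^ Suc k) g t) (at t))"

definition curv :: "(real \<Rightarrow> complex) \<Rightarrow> real \<Rightarrow> real" where
  "curv f t = Im (cnj (D f t) * D (D f) t) / cmod (D f t) ^ 3"

definition arcD :: "(real \<Rightarrow> complex) \<Rightarrow> (real \<Rightarrow> real) \<Rightarrow> real \<Rightarrow> real" where
  "arcD f g t = D g t / cmod (D f t)"

definition curv1 :: "(real \<Rightarrow> complex) \<Rightarrow> real \<Rightarrow> real" where
  "curv1 f = arcD f (curv f)"

definition curv2 :: "(real \<Rightarrow> complex) \<Rightarrow> real \<Rightarrow> real" where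
  "curv2 f = arcD f (arcD f (curv f))"

definition parallel_pair :: "(real \<Rightarrow> complex) \<Rightarrow> real \<Rightarrow> real \<Rightarrow> bool" where
  "parallel_pair f s t \<longleftrightarrow> ecirc s \<noteq> ecirc t \<and> Im (D f s * cnj (D f t)) = 0"

definition tsgn :: "(real \<Rightarrow> complex) \<Rightarrow> real \<Rightarrow> real \<Rightarrow> real" where
  "tsgn f s t = sgn (Re (D f s * cnj (D f t)))"

text \<open>kappa(a) + kappa(b) w.r.t. oppositely oriented local parameterisations\<close>
definition ksum :: "(real \<Rightarrow> complex) \<Rightarrow> real \<Rightarrow> real \<Rightarrow> real" where
  "ksum f s t = curv f s - tsgn f s t * curv f t"

definition css :: "(real \<Rightarrow> complex) \<Rightarrow> real \<Rightarrow> real \<Rightarrow> complex" where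
  "css f s t = (let ka = curv f s; kb = - tsgn f s t * curv f t
                in (of_real ka * f s + of_real kb * f t) / of_real (ka + kb))"

definition wigner :: "(real \<Rightarrow> complex) \<Rightarrow> real \<Rightarrow> real \<Rightarrow> complex" where
  "wigner f s t = (f s + f t) / 2"

definition on_line :: "complex \<Rightarrow> complex \<Rightarrow> complex \<Rightarrow> bool" where
  "on_line a b p \<longleftrightarrow> Im ((p - a) * cnj (b - a)) = 0"

definition rosette :: "(real \<Rightarrow> complex) \<Rightarrow> nat \<Rightarrow> bool" where
  "rosette f n \<longleftrightarrow> smooth_fun f \<and> (\<forall>t. f (t + 1) = f t) \<and> (\<forall>t. D f t \<noteq> 0)
     \<and> (\<forall>t. curv f t \<noteq> 0) \<and> winding_number (D f) 0 = of_nat n"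

definition generic_rosette :: "(real \<Rightarrow> complex) \<Rightarrow> nat \<Rightarrow> bool" where
  "generic_rosette f n \<longleftrightarrow> rosette f n
   \<comment> \<open>only transversal self-crossings\<close>
   \<and> (\<forall>s t. ecirc s \<noteq> ecirc t \<and> f s = f t \<longrightarrow> Im (D f s * cnj (D f t)) \<noteq> 0)
   \<comment> \<open>non-degeneracy conditions on parallel pairs\<close>
   \<and> (\<forall>s t. parallel_pair f s t \<and> curv1 f s * curv f t ^ 2 = curv f s ^ 2 * curv1 f t
        \<longrightarrow> curv2 f s * curv f t ^ 3 \<noteq> curv f s ^ 3 * curv2 f t)
   \<and> (\<forall>s t. parallel_pair f s t \<and> ksum f s t = 0
        \<longrightarrow> curv1 f s * curv f t ^ 2 \<noteq> curv f s ^ 2 * curv1 f t)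
   \<and> (\<forall>s t s' t'. parallel_pair f s t \<and> parallel_pair f s' t' \<and> ksum f s t = 0 \<and> ksum f s' t' = 0
        \<and> {ecirc s, ecirc t} \<noteq> {ecirc s', ecirc t'}
        \<longrightarrow> \<not> (on_line (f s) (f t) (f s') \<and> on_line (f s) (f t) (f t')))
   \<comment> \<open>self-intersections of the CSS are transversal\<close>
   \<and> (\<forall>s t s' t'. parallel_pair f s t \<and> parallel_pair f s' t' \<and> ksum f s t \<noteq> 0 \<and> ksum f s' t' \<noteq> 0
        \<and> {ecirc s, ecirc t} \<noteq> {ecirc s', ecirc t'} \<and> css f s t = css f s' t'
        \<longrightarrow> Im ((f t - f s) * cnj (f t' - f s')) \<noteq> 0)"

text \<open>The space of (ordered) parallel pairs on the torus S^1 x S^1; a smooth branch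
  is a maximal continuous family of (unordered) parallel pairs, i.e. a connected
  component together with its image under swapping.\<close>
definition pp_set :: "(real \<Rightarrow> complex) \<Rightarrow> (complex \<times> complex) set" where
  "pp_set f = {(ecirc s, ecirc t) | s t. parallel_pair f s t}"

definition branches :: "(real \<Rightarrow> complex) \<Rightarrow> (complex \<times> complex) set set" where
  "branches f = {C \<union> prod.swap ` C | C. C \<in> components (pp_set f)}"

definition traversal :: "(real \<Rightarrow> complex) \<Rightarrow> (complex \<times> complex) set \<Rightarrow> (real \<Rightarrow> real \<times> real) \<Rightarrow> bool" where
  "traversal f B \<gamma> \<longleftrightarrow>
     (let P = (\<lambda>u. (ecirc (fst (\<gamma> u)), ecirc (snd (\<gamma> u)))) in
       (\<forall>u\<in>{0..1}. \<gamma> differentiable (at u) \<and> D \<gamma> u \<noteq> 0 \<and> P u \<in> B)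
     \<and> (P 1 = P 0 \<or> P 1 = prod.swap (P 0))
     \<and> (\<forall>u\<in>{0..<1}. \<forall>v\<in>{0..<1}. u \<noteq> v \<longrightarrow> P u \<noteq> P v \<and> P u \<noteq> prod.swap (P v))
     \<and> B \<subseteq> P ` {0..1} \<union> prod.swap ` P ` {0..1})"

definition trav :: "(real \<Rightarrow> complex) \<Rightarrow> (complex \<times> complex) set \<Rightarrow> real \<Rightarrow> real \<times> real" where
  "trav f B = (SOME \<gamma>. traversal f B \<gamma>)"

definition css_cusps :: "(real \<Rightarrow> complex) \<Rightarrow> (real \<Rightarrow> real \<times> real) \<Rightarrow> real set" where
  "css_cusps f \<gamma> = {u \<in> {0..<1}. ksum f (fst (\<gamma> u)) (snd (\<gamma> u)) \<noteq> 0
        \<and> D (\<lambda>v. css f (fst (\<gamma> v)) (snd (\<gamma> v))) u = 0}"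

definition wc_cusps :: "(real \<Rightarrow> complex) \<Rightarrow> (real \<Rightarrow> real \<times> real) \<Rightarrow> real set" where
  "wc_cusps f \<gamma> = {u \<in> {0..<1}. D (\<lambda>v. wigner f (fst (\<gamma> v)) (snd (\<gamma> v))) u = 0}"

definition css_cusp_count :: "(real \<Rightarrow> complex) \<Rightarrow> (complex \<times> complex) set \<Rightarrow> nat" where
  "css_cusp_count f B = card (css_cusps f (trav f B))"

definition wc_cusp_count :: "(real \<Rightarrow> complex) \<Rightarrow> (complex \<times> complex) set \<Rightarrow> nat" where
  "wc_cusp_count f B = card (wc_cusps f (trav f B))"

text \<open>continuous unit normal field cis (phi u) along the CSS branch (orthogonal to the
  velocity wherever the branch point is finite), and the resulting rotation number\<close>
definition normal_lift :: "(real \<Rightarrow> complex) \<Rightarrow> (real \<Rightarrow> real \<times> real) \<Rightarrow> (real \<Rightarrow> real) \<Rightarrow> bool" where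
  "normal_lift f \<gamma> \<phi> \<longleftrightarrow> continuous_on {0..1} \<phi> \<and>
     (\<forall>u\<in>{0..1}. ksum f (fst (\<gamma> u)) (snd (\<gamma> u)) \<noteq> 0 \<longrightarrow>
        Re (cnj (cis (\<phi> u)) * D (\<lambda>v. css f (fst (\<gamma> v)) (snd (\<gamma> v))) u) = 0)"

definition css_rot :: "(real \<Rightarrow> complex) \<Rightarrow> (complex \<times> complex) set \<Rightarrow> real" where
  "css_rot f B = (let \<gamma> = trav f B; \<phi> = (SOME \<phi>. normal_lift f \<gamma> \<phi>)
                  in (\<phi> 1 - \<phi> 0) / (2 * pi))"

definition has_asymptote :: "(real \<Rightarrow> complex) \<Rightarrow> (complex \<times> complex) set \<Rightarrow> bool" where
  "has_asymptote f B \<longleftrightarrow> (\<exists>s t. (ecirc s, ecirc t) \<in> B \<and> ksum f s t = 0)"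

end

theory Submission
  imports Defs
begin

text \<open>
  Since the curvature never vanishes, the tangent angle \<open>\<theta>\<close> is a diffeomorphism of the line with
  \<open>\<theta> (t + 1) = \<theta> t + 2 \<pi> n\<close>. Two points form a parallel pair iff their angles differ by \<open>m \<pi>\<close> with
  \<open>2 n\<close> not dividing \<open>m\<close>, so the ordered parallel pairs form \<open>2 n - 1\<close> disjoint circles; swapping
  exchanges \<open>m\<close> and \<open>2 n - m\<close>, which leaves \<open>n\<close> branches, the one with \<open>m = n\<close> being swapped into itself.

  Put \<open>G y = ln \<kappa>(y + m \<pi>) - ln \<kappa>(y)\<close> in terms of the angle \<open>y\<close>. The velocity of the centre symmetry set
  is a multiple of \<open>G' y\<close> times the chord of the pair, so its cusps are the zeros of \<open>G'\<close>, which are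
  simple by genericity. An asymptote occurs iff \<open>m\<close> is even and \<open>G\<close> vanishes, and for odd \<open>m\<close> the cusps of the
  Wigner caustic are the zeros of \<open>G\<close>. Traversing a branch sweeps the angle \<open>2 \<pi> n\<close>, under which \<open>G\<close> and
  the chord are periodic; for \<open>m = n\<close> it sweeps only \<open>\<pi> n\<close>, under which both are antiperiodic. This
  sign gives the parity of the number of cusps and decides between integer and half-integer rotation number,
  and Rolle's theorem on the circle compares the two numbers of cusps.
\<close>

section \<open>Zeros of quasi-periodic functions\<close>

text \<open>Infinitely many zeros in a compact interval would accumulate at some \<open>l\<close>.
  By continuity \<open>l\<close> is a zero as well, and the difference quotients at \<open>l\<close>
  vanish along the accumulating zeros, so \<open>h' l\<close> would be \<open>0\<close>.\<close>

lemma simple_zeros_finite: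
  fixes h h' :: "real \<Rightarrow> real"
  assumes deriv: "\<And>x. (h has_real_derivative h' x) (at x)"
    and simple: "\<And>x. h x = 0 \<Longrightarrow> h' x \<noteq> 0"
  shows "finite {x \<in> {a..b}. h x = 0}"
proof (rule ccontr)
  let ?Z = "{x \<in> {a..b}. h x = 0}"
  assume "infinite ?Z"
  then obtain l where l: "l \<in> {a..b}" "l islimpt ?Z"
    using compact_eq_Bolzano_Weierstrass[of "{a..b}"] by (metis (no_types, lifting) compact_Icc mem_Collect_eq subsetI)
  have cont: "continuous_on UNIV h"
    using deriv by (meson DERIV_isCont continuous_at_imp_continuous_on)
  have "closed (h -` {0})"
    using continuous_closed_vimage[of "{0}" h] cont by (simp add: continuous_on_eq_continuous_at)
  moreover have "l islimpt (h -` {0})"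
    using l(2) by (rule islimpt_subset) auto
  ultimately have hl: "h l = 0"
    by (auto simp: closed_limpt)
  have "((\<lambda>x. (h x - h l) / (x - l)) \<longlongrightarrow> h' l) (at l)"
    using deriv[of l] by (simp add: has_field_derivative_iff)
  then have "\<forall>\<^sub>F x in at l. (h x - h l) / (x - l) \<noteq> 0"
    using simple[OF hl] by (rule tendsto_imp_eventually_ne)
  then have "\<forall>\<^sub>F x in at l. x \<notin> ?Z"
    by eventually_elim (auto simp: hl)
  then show False
    using l(2) by (simp add: islimpt_iff_eventually)
qed

lemma same_sign_if_no_zero:
  fixes h :: "real \<Rightarrow> real"
  assumes "continuous_on {a..b} h" "a \<le> b" "\<And>x. x \<in> {a..b} \<Longrightarrow> h x \<noteq> 0"
  shows "h a > 0 \<longleftrightarrow> h b > 0"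
proof (rule ccontr)
  assume "\<not> ?thesis"
  then consider "h a \<le> 0" "0 \<le> h b" | "h b \<le> 0" "0 \<le> h a" by linarith
  then obtain x where "a \<le> x" "x \<le> b" "h x = 0"
    using IVT'[of h a 0 b] IVT2'[of h b 0 a] assms by cases blast+
  with assms(3)[of x] show False by auto
qed

lemma sign_change_at_simple_zero:
  fixes h :: "real \<Rightarrow> real"
  assumes "(h has_real_derivative c) (at z)" "h z = 0" "c \<noteq> 0"
  obtains d where "d > 0" "\<And>e. 0 < e \<Longrightarrow> e < d \<Longrightarrow> h (z - e) * h (z + e) < 0"
proof (cases "c > 0")
  case True
  from DERIV_pos_inc_right[OF assms(1) True] DERIV_pos_inc_left[OF assms(1) True]
  obtain d1 d2 where "d1 > 0" "d2 > 0" "\<And>e. 0 < e \<Longrightarrow> e < d1 \<Longrightarrow> h (z + e) > 0"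
    "\<And>e. 0 < e \<Longrightarrow> e < d2 \<Longrightarrow> h (z - e) < 0" using assms(2) by auto
  then show ?thesis
    by (intro that[of "min d1 d2"]) (auto simp: mult_neg_pos)
next
  case False
  then have "c < 0" using assms(3) by simp
  from DERIV_neg_dec_right[OF assms(1) this] DERIV_neg_dec_left[OF assms(1) this]
  obtain d1 d2 where "d1 > 0" "d2 > 0" "\<And>e. 0 < e \<Longrightarrow> e < d1 \<Longrightarrow> h (z + e) < 0"
    "\<And>e. 0 < e \<Longrightarrow> e < d2 \<Longrightarrow> h (z - e) > 0" using assms(2) by auto
  then show ?thesis
    by (intro that[of "min d1 d2"]) (auto simp: mult_pos_neg)
qed

text \<open>Each simple zero flips the sign. The induction removes the leftmost zero by moving the
  left end of the interval just beyond it.\<close>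

lemma simple_zeros_parity:
  fixes h h' :: "real \<Rightarrow> real"
  assumes deriv: "\<And>x. (h has_real_derivative h' x) (at x)"
    and simple: "\<And>x. h x = 0 \<Longrightarrow> h' x \<noteq> 0"
    and "a \<le> b" "h a \<noteq> 0" "h b \<noteq> 0"
  shows "even (card {x \<in> {a..b}. h x = 0}) \<longleftrightarrow> (h a > 0 \<longleftrightarrow> h b > 0)"
  using assms(3-5)
proof (induction "card {x \<in> {a..b}. h x = 0}" arbitrary: a rule: less_induct)
  case less
  let ?Z = "\<lambda>a. {x \<in> {a..b}. h x = 0}"
  have fin: "finite (?Z a)" for a
    by (rule simple_zeros_finite[OF deriv simple])
  have cont: "continuous_on S h" for S
    using deriv by (meson DERIV_isCont continuous_at_imp_continuous_on)
  show ?case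
  proof (cases "?Z a = {}")
    case True
    then have "h a > 0 \<longleftrightarrow> h b > 0"
      using less.prems by (intro same_sign_if_no_zero cont) auto
    with True show ?thesis by (simp only: card.empty) simp
  next
    case False
    define z where "z = Min (?Z a)"
    have z: "z \<in> ?Z a" and zmin: "\<And>x. x \<in> ?Z a \<Longrightarrow> z \<le> x"
      using Min_in[OF fin False] Min_le[OF fin] by (auto simp: z_def)
    then have zab: "a < z" "z < b" "h z = 0"
      using less.prems by (auto simp: less_le)
    obtain d where d: "d > 0" "\<And>e. 0 < e \<Longrightarrow> e < d \<Longrightarrow> h (z - e) * h (z + e) < 0"
      using sign_change_at_simple_zero[OF deriv[of z] zab(3) simple[OF zab(3)]] by blast
    \<comment> \<open>Half of the minimum keeps \<open>z - e\<close> and \<open>z + e\<close>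
      strictly inside the interval and within the radius on which the sign change at
      \<open>z\<close> is known.\<close>
    define e where "e = min d (min (z - a) (b - z)) / 2"
    have e: "0 < e" "e < d" "e < z - a" "e < b - z"
      using d zab by (auto simp: e_def min_def)
    have opp: "h (z - e) * h (z + e) < 0" using d e by blast
    have sgn1: "h a > 0 \<longleftrightarrow> h (z - e) > 0"
      using e zmin zab by (intro same_sign_if_no_zero cont) force+
    have sgn2: "h (z - e) > 0 \<longleftrightarrow> \<not> h (z + e) > 0"
      using opp by (auto simp: mult_less_0_iff)
    have Zeq: "?Z a = insert z (?Z (z + e))"
    proof -
      \<comment> \<open>The product \<open>h (z - e) * h (z + e)\<close> is negative for every small
        distance, so no second zero hides between \<open>z\<close> and the new left end.\<close>
      have gap: "h x \<noteq> 0" if "z < x" "x < z + e" for x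
        using d(2)[of "x - z"] that e by auto
      have "x = z \<or> z + e \<le> x" if "x \<in> ?Z a" for x
        using gap[of x] zmin[OF that] that by (cases "x = z"; cases "x < z + e") auto
      then show ?thesis using z e zab by auto
    qed
    have cardZ: "card (?Z a) = Suc (card (?Z (z + e)))"
      using e by (subst Zeq, intro card_insert_disjoint fin) auto
    have IH: "even (card (?Z (z + e))) \<longleftrightarrow> (h (z + e) > 0 \<longleftrightarrow> h b > 0)"
    proof (rule less.hyps)
      show "card (?Z (z + e)) < card (?Z a)" unfolding cardZ by (rule lessI)
      show "z + e \<le> b" using e by linarith
      show "h (z + e) \<noteq> 0" using opp by force
    qed (rule less.prems)
    show ?thesis unfolding cardZ even_Suc IH sgn1 sgn2 by blast
  qed
qed

lemma periodic_int:
  fixes g :: "real \<Rightarrow> 'a"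
  assumes per: "\<And>y. g (y + L) = g y"
  shows "g (y + of_int j * L) = g y"
proof -
  have nat: "g (y + of_nat i * L) = g y" for y and i :: nat
  proof (induction i)
    case (Suc i)
    then show ?case using per[of "y + of_nat i * L"] by (simp add: algebra_simps)
  qed simp
  \<comment> \<open>For negative \<open>j\<close> the natural number case is applied at the
    translated point, going back to \<open>y\<close>.\<close>
  show ?thesis
    using nat[of y "nat j"] nat[of "y + of_int j * L" "nat (- j)"] by (cases "j \<ge> 0") auto
qed

text \<open>Reduction modulo \<open>L\<close> is a bijection between any two half-open intervals of
  length \<open>L\<close>; \<open>r c y\<close> is the representative of \<open>y\<close> in the
  interval that starts at \<open>c\<close>.\<close>

lemma card_periodic_Ico:
  fixes P :: "real \<Rightarrow> bool"
  assumes "L > 0" and per: "\<And>y. P (y + L) \<longleftrightarrow> P y"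
  shows "card {y \<in> {c..<c + L}. P y} = card {y \<in> {d..<d + L}. P y}"
proof -
  define r where "r c y = y - of_int \<lfloor>(y - c) / L\<rfloor> * L" for c y
  have r: "r c y \<in> {c..<c + L}" for c y
    using floor_divide_lower[OF assms(1), of "y - c"] floor_divide_upper[OF assms(1), of "y - c"]
    by (auto simp: r_def algebra_simps)
  have rP: "P (r c y) \<longleftrightarrow> P y" for c y
    using periodic_int[of P L y "- \<lfloor>(y - c) / L\<rfloor>"] per by (simp add: r_def)
  have rr: "r c (r d y) = y" if "y \<in> {c..<c + L}" for c d y
  proof -
    let ?k = "\<lfloor>(y - d) / L\<rfloor>"
    have "\<lfloor>(y - c) / L\<rfloor> = 0" using that assms(1) by (auto simp: floor_eq_iff)
    moreover have "(r d y - c) / L = (y - c) / L - of_int ?k"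
      using assms(1) by (simp add: r_def field_simps)
    ultimately have "\<lfloor>(r d y - c) / L\<rfloor> = - ?k" by simp
    then show ?thesis by (simp add: r_def[of c] r_def[of d])
  qed
  have "bij_betw (r d) {y \<in> {c..<c + L}. P y} {y \<in> {d..<d + L}. P y}"
    by (rule bij_betw_byWitness[where f' = "r c"]) (use r rP rr in auto)
  then show ?thesis by (rule bij_betw_same_card)
qed

text \<open>A decreasing parametrization sends \<open>{0..<1}\<close> to an interval that is open on
  the left, so this variant is needed too. The bijection moves one end point to the other.\<close>

lemma card_periodic_Ioc:
  fixes P :: "real \<Rightarrow> bool"
  assumes "L > 0" and per: "\<And>y. P (y + L) \<longleftrightarrow> P y"
  shows "card {y \<in> {c<..c + L}. P y} = card {y \<in> {c..<c + L}. P y}"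
proof -
  have "bij_betw (\<lambda>y. if y = c + L then c else y) {y \<in> {c<..c + L}. P y} {y \<in> {c..<c + L}. P y}"
    by (rule bij_betw_byWitness[where f' = "\<lambda>y. if y = c then c + L else y"])
      (use assms in \<open>auto split: if_splits\<close>)
  then show ?thesis by (rule bij_betw_same_card)
qed

text \<open>Starting the period at a point \<open>d\<close> that is not a zero, the signs at
  \<open>d\<close> and \<open>d + L\<close> agree exactly when \<open>\<sigma> = 1\<close>, and the
  parity count between two nonzero values applies.\<close>

lemma simple_zeros_parity_quasiperiodic:
  fixes h h' :: "real \<Rightarrow> real"
  assumes deriv: "\<And>x. (h has_real_derivative h' x) (at x)"
    and simple: "\<And>x. h x = 0 \<Longrightarrow> h' x \<noteq> 0"
    and "L > 0" and quasi: "\<And>y. h (y + L) = \<sigma> * h y" and sigma: "\<sigma> = 1 \<or> \<sigma> = -1"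
  shows "even (card {y \<in> {c..<c + L}. h y = 0}) \<longleftrightarrow> \<sigma> = 1"
proof -
  have "finite {y \<in> {0..1}. h y = 0}"
    by (rule simple_zeros_finite[OF deriv simple])
  moreover have "infinite {0..1::real}" by (simp add: infinite_Icc)
  ultimately have "infinite ({0..1} - {y \<in> {0..1}. h y = 0})"
    by (rule Diff_infinite_finite)
  then have "{0..1} - {y \<in> {0..1}. h y = 0} \<noteq> {}" by (metis finite.emptyI)
  then obtain d where d: "h d \<noteq> 0" by auto
  have dL: "h (d + L) \<noteq> 0" using d quasi sigma by auto
  have "card {y \<in> {c..<c + L}. h y = 0} = card {y \<in> {d..<d + L}. h y = 0}"
    using quasi sigma by (intro card_periodic_Ico assms) auto
  also have "{y \<in> {d..<d + L}. h y = 0} = {y \<in> {d..d + L}. h y = 0}"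
    using dL by (auto simp: less_le)
  finally have "even (card {y \<in> {c..<c + L}. h y = 0}) \<longleftrightarrow> (h d > 0 \<longleftrightarrow> h (d + L) > 0)"
    using simple_zeros_parity[OF deriv simple _ d dL] \<open>L > 0\<close> by simp
  also have "\<dots> \<longleftrightarrow> \<sigma> = 1" using quasi[of d] sigma d by auto
  finally show ?thesis .
qed

text \<open>Induction adds the zeros in increasing order. Each new largest zero brings a zero of the
  derivative strictly between itself and the previous maximum, hence outside the interval already
  counted.\<close>

lemma Rolle_card:
  fixes g g' :: "real \<Rightarrow> real"
  assumes deriv: "\<And>x. (g has_real_derivative g' x) (at x)"
    and fin': "\<And>a b. finite {x \<in> {a..b}. g' x = 0}"
    and "finite Z" "Z \<noteq> {}" "\<And>z. z \<in> Z \<Longrightarrow> g z = 0"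
  shows "card Z \<le> Suc (card {x \<in> {Min Z..<Max Z}. g' x = 0})"
  using assms(3-5)
proof (induction Z rule: finite_linorder_max_induct)
  case (insert b A)
  show ?case
  proof (cases "A = {}")
    case False
    let ?C = "\<lambda>a b. {x \<in> {a..<b}. g' x = 0}"
    have fin: "finite (?C a b)" for a b
      by (rule finite_subset[OF _ fin'[of a b]]) auto
    have M: "Max A < b" "Min A \<le> Max A" "Max A \<in> A" using insert False by auto
    have "Max (insert b A) = max b (Max A)" "Min (insert b A) = min b (Min A)"
      using insert.hyps(1) False by simp_all
    then have Mi: "Max (insert b A) = b" "Min (insert b A) = Min A"
      using M by simp_all
    have "\<exists>x. Max A < x \<and> x < b \<and> g' x = 0"
    proof -
      have "continuous_on {Max A..b} g"
        using deriv by (meson DERIV_isCont continuous_at_imp_continuous_on)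
      \<comment> \<open>\<open>Rolle_deriv\<close> speaks of the derivative as a linear map, which
        is multiplication by \<open>g' x\<close>; evaluating it at \<open>1\<close> recovers the
        number.\<close>
      then obtain x where "Max A < x" "x < b" "(\<lambda>v. v * g' x) = (\<lambda>v. 0)"
        using Rolle_deriv[of "Max A" b g "\<lambda>x v. v * g' x"] M insert
          deriv[THEN has_field_derivative_imp_has_derivative] by (auto simp: mult_commute_abs)
      then show ?thesis using fun_cong[of "\<lambda>v. v * g' x" "\<lambda>v. 0" 1] by auto
    qed
    then obtain x where x: "Max A < x" "x < b" "g' x = 0" by auto
    have "card A \<le> Suc (card (?C (Min A) (Max A)))" using insert False by auto
    also have "Suc (card (?C (Min A) (Max A))) = card (insert x (?C (Min A) (Max A)))"
      using x by (subst card_insert_disjoint[OF fin]) auto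
    also have "\<dots> \<le> card (?C (Min A) b)"
      using x M by (intro card_mono fin) auto
    finally have "card A \<le> card (?C (Min A) b)" .
    moreover have "card (insert b A) \<le> Suc (card A)" by (rule card_insert_le_m1) auto
    ultimately show ?thesis unfolding Mi by linarith
  qed auto
qed auto

text \<open>On a circle there are as many gaps as zeros. The circle is cut open at the smallest zero
  \<open>z\<close>, and its translate \<open>z + L\<close> is added as a further zero to supply the
  last gap.\<close>

lemma Rolle_card_quasiperiodic:
  fixes g g' :: "real \<Rightarrow> real"
  assumes deriv: "\<And>x. (g has_real_derivative g' x) (at x)"
    and fin': "\<And>a b. finite {x \<in> {a..b}. g' x = 0}"
    and "L > 0" and per: "\<And>y. g (y + L) = 0 \<longleftrightarrow> g y = 0" "\<And>y. g' (y + L) = 0 \<longleftrightarrow> g' y = 0"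
  shows "card {y \<in> {c..<c + L}. g y = 0} \<le> card {y \<in> {c..<c + L}. g' y = 0}"
\<comment> \<open>An infinite or empty set of zeros has \<open>card\<close> equal to
  \<open>0\<close>, so only a finite nonempty set needs an argument.\<close>
proof (cases "finite {y \<in> {c..<c + L}. g y = 0} \<and> {y \<in> {c..<c + L}. g y = 0} \<noteq> {}")
  case True
  define Z where "Z = {y \<in> {c..<c + L}. g y = 0}"
  have Z: "finite Z" "Z \<noteq> {}" using True by (auto simp: Z_def)
  define z where "z = Min Z"
  have z: "z \<in> Z" using Min_in[OF Z] by (simp add: z_def)
  have lt: "y < z + L" if "y \<in> Z" for y using that z by (auto simp: Z_def)
  have "Max (insert (z + L) Z) = z + L" "Min (insert (z + L) Z) = z"
    using Z lt z Min_le[OF Z(1)] assms(3)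
    by (auto intro!: Max_eqI Min_eqI simp: z_def[symmetric] less_imp_le)
  moreover have "card (insert (z + L) Z) = Suc (card Z)"
    using lt Z by (subst card_insert_disjoint) auto
  moreover have "card (insert (z + L) Z) \<le> Suc (card {x \<in> {Min (insert (z + L) Z)..<Max (insert (z + L) Z)}. g' x = 0})"
    using Z z per by (intro Rolle_card[OF deriv fin']) (auto simp: Z_def)
  ultimately have "card Z \<le> card {x \<in> {z..<z + L}. g' x = 0}" by simp
  also have "\<dots> = card {x \<in> {c..<c + L}. g' x = 0}"
    using assms by (intro card_periodic_Ico) auto
  finally show ?thesis by (simp add: Z_def)
qed (metis card.infinite card.empty le0)

text \<open>Every point of \<open>{0..1}\<close> is a limit point of it, so a nonzero value would
  spread to infinitely many points. This later carries orthogonality of the normal across cusps and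
  asymptotes.\<close>

lemma continuous_eq_0_off_finite:
  fixes w :: "real \<Rightarrow> real"
  assumes cont: "continuous_on {0..1} w" and fin: "finite {u \<in> {0..1}. w u \<noteq> 0}" and u: "u \<in> {0..1}"
  shows "w u = 0"
proof (rule ccontr)
  assume ne: "w u \<noteq> 0"
  have "u islimpt {0..1}"
    using u connected_imp_perfect[of "{0..1::real}" u] by auto
  then have nt: "\<not> trivial_limit (at u within {0..1})"
    by (simp add: trivial_limit_within)
  have "\<forall>\<^sub>F v in at u within {0..1}. w v \<noteq> 0"
    using cont u ne by (intro tendsto_imp_eventually_ne) (auto simp: continuous_on_def)
  moreover have "\<forall>\<^sub>F v in at u within {0..1}. v \<in> {0..1}"
    by (simp add: eventually_at_filter)
  moreover have "\<forall>\<^sub>F v in at u. v \<notin> {u \<in> {0..1}. w u \<noteq> 0}"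
    using islimpt_finite[OF fin, of u] islimpt_iff_eventually by blast
  then have "\<forall>\<^sub>F v in at u within {0..1}. v \<notin> {u \<in> {0..1}. w u \<noteq> 0}"
    by (metis at_le filter_leD top_greatest)
  ultimately have "\<forall>\<^sub>F v in at u within {0..1}. False"
    by eventually_elim auto
  with nt show False by simp
qed

section \<open>The tangent angle of a rosette\<close>

lemma D_eqI: "(g has_vector_derivative g') (at t) \<Longrightarrow> D g t = g'"
  by (simp add: D_def vector_derivative_at)

lemma has_D_if_differentiable:
  "g differentiable (at t) \<Longrightarrow> (g has_vector_derivative D g t) (at t)"
  by (simp add: D_def vector_derivative_works)

lemma smooth_fun_has_D: "smooth_fun f \<Longrightarrow> (f has_vector_derivative D f t) (at t)"
  unfolding smooth_fun_def by (drule spec[of _ 0]) simp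

lemma smooth_fun_D: "smooth_fun f \<Longrightarrow> smooth_fun (D f)"
  unfolding smooth_fun_def by (metis comp_apply funpow_Suc_right)

lemma D_periodic:
  assumes "smooth_fun f" "\<And>t. f (t + 1) = f t"
  shows "D f (t + 1) = D f t"
proof -
  have "((\<lambda>t. t + 1) has_vector_derivative 1) (at t)"
    by (auto intro!: derivative_eq_intros)
  then have "(f \<circ> (\<lambda>t. t + 1) has_vector_derivative 1 *\<^sub>R D f (t + 1)) (at t)"
    by (rule vector_diff_chain_at) (rule smooth_fun_has_D[OF assms(1)])
  moreover have "f \<circ> (\<lambda>t. t + 1) = f" using assms(2) by auto
  ultimately show ?thesis using D_eqI[of f "D f (t + 1)" t] by simp
qed

text \<open>In coordinates the curvature is a determinant of derivatives divided by the cube of the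
  speed. Its derivative is computed explicitly, because only the explicit quotient shows that the
  arc length derivative \<open>curv1 f\<close> is differentiable again.\<close>

lemma curv_differentiable:
  assumes sm: "smooth_fun f" and reg: "\<And>t. D f t \<noteq> 0"
  shows "curv f differentiable (at t)" and "curv1 f differentiable (at t)"
proof -
  \<comment> \<open>\<open>a i\<close> and \<open>b i\<close> are the coordinates of the derivative
    of order \<open>i + 1\<close>. In \<open>c'\<close> the two products of second derivatives have
    already cancelled.\<close>
  define a where "a i t = Re ((D ^^ Suc i) f t)" for i t
  define b where "b i t = Im ((D ^^ Suc i) f t)" for i t
  define N where "N t = cmod (D f t)" for t
  define c where "c t = a 0 t * b 1 t - b 0 t * a 1 t" for t
  define c' where "c' t = a 0 t * b 2 t - b 0 t * a 2 t" for t
  define N' where "N' t = (a 0 t * a 1 t + b 0 t * b 1 t) / N t" for t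
  have vd: "((D ^^ Suc i) f has_vector_derivative (D ^^ Suc (Suc i)) f t) (at t)" for i t
    using sm unfolding smooth_fun_def by blast
  have da: "(a i has_real_derivative a (Suc i) t) (at t)" for i t
    unfolding a_def has_real_derivative_iff_has_vector_derivative
    by (rule bounded_linear.has_vector_derivative[OF bounded_linear_Re vd])
  have db: "(b i has_real_derivative b (Suc i) t) (at t)" for i t
    unfolding b_def has_real_derivative_iff_has_vector_derivative
    by (rule bounded_linear.has_vector_derivative[OF bounded_linear_Im vd])
  have Npos: "N t > 0" for t using reg by (simp add: N_def)
  have Neq: "N = (\<lambda>t. sqrt ((a 0 t)\<^sup>2 + (b 0 t)\<^sup>2))"
    by (simp add: N_def a_def b_def cmod_def fun_eq_iff)
  have dN: "(N has_real_derivative N' t) (at t)" for t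
  proof -
    have "(a 0 t)\<^sup>2 + (b 0 t)\<^sup>2 > 0"
      using Npos[of t] by (simp add: Neq)
    then have "((\<lambda>t. sqrt ((a 0 t)\<^sup>2 + (b 0 t)\<^sup>2)) has_real_derivative N' t) (at t)"
      unfolding N'_def Neq
      by (auto intro!: derivative_eq_intros da[of 0, simplified] db[of 0, simplified] simp: field_simps,
          simp add: add_divide_distrib)
    then show ?thesis by (simp only: Neq)
  qed
  have dc: "(c has_real_derivative c' t) (at t)" for t
    unfolding c_def c'_def using da[of 0 t] db[of 0 t] da[of 1 t] db[of 1 t]
    by (auto intro!: derivative_eq_intros simp: numeral_2_eq_2 algebra_simps)
  have curv: "curv f = (\<lambda>t. c t / N t ^ 3)"
    by (auto simp: curv_def c_def N_def a_def b_def fun_eq_iff)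
  have dcurv: "(curv f has_real_derivative (c' t * N t ^ 3 - c t * (3 * N t ^ 2 * N' t)) / (N t ^ 3 * N t ^ 3)) (at t)" for t
    unfolding curv using Npos[of t] dN[of t] dc[of t]
    by (auto intro!: derivative_eq_intros)
  then show "curv f differentiable (at t)"
    using real_differentiable_def by blast
  have "D (curv f) = (\<lambda>t. (c' t * N t ^ 3 - c t * (3 * N t ^ 2 * N' t)) / (N t ^ 3 * N t ^ 3))"
    using dcurv by (intro ext D_eqI) (simp add: has_real_derivative_iff_has_vector_derivative)
  then have curv1: "curv1 f = (\<lambda>t. (c' t * N t ^ 3 - c t * (3 * N t ^ 2 * N' t)) / (N t ^ 3 * N t ^ 3) / N t)"
    by (simp add: curv1_def arcD_def N_def fun_eq_iff)
  have diff: "a i differentiable (at t)" "b i differentiable (at t)" "N differentiable (at t)" "c differentiable (at t)" for i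
    using da db dN dc real_differentiable_def by blast+
  show "curv1 f differentiable (at t)"
    unfolding curv1 c'_def N'_def using Npos[of t]
    by (intro derivative_intros diff) auto
qed

text \<open>The angle is the imaginary part of a global logarithm of \<open>D f\<close>, obtained by
  integrating the logarithmic derivative \<open>q\<close>. This gives the derivative of the angle
  directly, and the increment over a period is an integral that computes the winding number.\<close>

lemma angle_function:
  assumes "rosette f n"
  obtains \<theta> where "\<And>t. (\<theta> has_real_derivative curv f t * cmod (D f t)) (at t)"
    "\<And>t. D f t = of_real (cmod (D f t)) * cis (\<theta> t)"
    "\<And>t. \<theta> (t + 1) = \<theta> t + 2 * pi * n"
proof -
  have sm: "smooth_fun f" and per: "\<And>t. f (t + 1) = f t" and reg: "\<And>t. D f t \<noteq> 0"
    and wn: "winding_number (D f) 0 = of_nat n"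
    using assms by (auto simp: rosette_def)
  have vd1: "(D f has_vector_derivative D (D f) t) (at t)" for t
    by (rule smooth_fun_has_D[OF smooth_fun_D[OF sm]])
  have vd2: "(D (D f) has_vector_derivative D (D (D f)) t) (at t)" for t
    by (rule smooth_fun_has_D[OF smooth_fun_D[OF smooth_fun_D[OF sm]]])
  have cont1: "isCont (D f) t" and cont2: "isCont (D (D f)) t" for t
    using vd1 vd2 has_vector_derivative_continuous by blast+
  have per1: "D f (t + 1) = D f t" for t by (rule D_periodic[OF sm per])
  have per2: "D (D f) (t + 1) = D (D f) t" for t by (rule D_periodic[OF smooth_fun_D[OF sm] per1])
  define q where "q t = D (D f) t / D f t" for t
  have "\<exists>F. \<forall>x::real. -\<infinity> < ereal x \<longrightarrow> ereal x < \<infinity> \<longrightarrow> (F has_vector_derivative q x) (at x)"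
    by (rule einterval_antiderivative) (auto simp: q_def intro!: continuous_intros cont1 cont2 reg)
  then obtain L0 where L0: "\<And>t. (L0 has_vector_derivative q t) (at t)" by auto
  \<comment> \<open>The constant is chosen such that \<open>exp (L 0) = D f 0\<close>; the quotient
    \<open>E\<close> below has derivative zero and therefore stays equal to
    \<open>1\<close>.\<close>
  define L where "L t = L0 t - L0 0 + Ln (D f 0)" for t
  have L: "(L has_vector_derivative q t) (at t)" for t
    unfolding L_def by (auto intro!: derivative_eq_intros L0)
  have expL: "D f t = exp (L t)" for t
  proof -
    define E where "E t = D f t * exp (- L t)" for t
    have "(E has_vector_derivative 0) (at t)" for t
    proof -
      have "((\<lambda>t. - L t) has_vector_derivative - q t) (at t)"
        by (auto intro!: derivative_eq_intros L)
      from field_vector_diff_chain_at[OF this DERIV_exp]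
      have "((\<lambda>t. exp (- L t)) has_vector_derivative - q t * exp (- L t)) (at t)"
        by (simp add: o_def)
      from has_vector_derivative_mult[OF vd1 this] show ?thesis
        unfolding E_def by (rule has_vector_derivative_eq_rhs) (simp add: q_def reg)
    qed
    then obtain c where c: "\<And>t. E t = c"
      using has_vector_derivative_zero_constant[of UNIV E] by auto
    moreover have "E 0 = 1" using reg[of 0] by (simp add: E_def L_def exp_minus)
    ultimately have "E t = 1" by metis
    then show ?thesis by (simp add: E_def exp_minus field_simps)
  qed
  have "\<exists>c. \<forall>t. L (t + 1) - L t = c"
  proof -
    have "((\<lambda>t. L (t + 1) - L t) has_vector_derivative 0) (at t)" for t
    proof -
      have "((\<lambda>t. t + 1) has_vector_derivative 1) (at t)"
        by (auto intro!: derivative_eq_intros)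
      from vector_diff_chain_at[OF this L]
      have "((\<lambda>t. L (t + 1)) has_vector_derivative q (t + 1)) (at t)" by (simp add: o_def)
      from has_vector_derivative_diff[OF this L] show ?thesis
        by (rule has_vector_derivative_eq_rhs) (simp add: q_def per1 per2)
    qed
    then obtain c where "\<And>t. L (t + 1) - L t = c"
      using has_vector_derivative_zero_constant[of UNIV "\<lambda>t. L (t + 1) - L t"] by auto
    then show ?thesis by blast
  qed
  then have shift: "L (t + 1) - L t = L 1 - L 0" for t by (metis add_0)
  have "valid_path (D f)"
    unfolding valid_path_def
    by (rule C1_differentiable_imp_piecewise)
      (auto simp: C1_differentiable_on_def intro!: exI[of _ "D (D f)"] vd1 continuous_at_imp_continuous_on cont2)
  then have "winding_number (D f) 0 = 1 / (2 * pi * \<i>) * contour_integral (D f) (\<lambda>w. 1 / (w - 0))"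
    by (rule winding_number_valid_path) (auto simp: path_image_def reg)
  also have "contour_integral (D f) (\<lambda>w. 1 / (w - 0)) = integral {0..1} q"
    \<comment> \<open>The integrand of dw / w along the closed curve \<open>D f\<close> is exactly
      \<open>q\<close>.\<close>
    by (simp add: contour_integral_integral q_def[abs_def] D_def)
  also have "integral {0..1} q = L 1 - L 0"
    using L by (intro integral_unique fundamental_theorem_of_calculus)
      (auto intro: has_vector_derivative_at_within)
  finally have "L 1 - L 0 = 2 * pi * \<i> * of_nat n"
    using wn by (simp add: field_simps)
  then have Im: "Im (L (t + 1)) = Im (L t) + 2 * pi * n" for t
    using arg_cong[OF shift[of t], of Im] by simp
  show ?thesis
  proof (rule that[of "\<lambda>t. Im (L t)"])
    show "((\<lambda>t. Im (L t)) has_real_derivative curv f t * cmod (D f t)) (at t)" for t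
    proof -
      have "Im (q t) = curv f t * cmod (D f t)"
        unfolding q_def curv_def complex_div_cnj[of "D (D f) t"]
        using reg[of t] by (simp add: Im_divide_of_real power2_eq_square power3_eq_cube field_simps flip: of_real_power)
      then show ?thesis
        using bounded_linear.has_vector_derivative[OF bounded_linear_Im L[of t]]
        by (simp add: has_real_derivative_iff_has_vector_derivative)
    qed
    show "D f t = of_real (cmod (D f t)) * cis (Im (L t))" for t
      unfolding expL by (simp add: exp_eq_polar norm_mult)
  qed (rule Im)
qed

text \<open>By the mean value theorem \<open>2 * pi * n\<close> equals curvature times speed at some
  \<open>z\<close>. The left side is nonnegative and the right side is nonzero, so both are
  positive; a continuous curvature without zeros then keeps this sign everywhere.\<close>

lemma rosette_curv_pos:
  assumes "rosette f n"
  shows "n > 0" "curv f t > 0"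
proof -
  obtain \<theta> where d: "\<And>t. (\<theta> has_real_derivative curv f t * cmod (D f t)) (at t)"
    and per: "\<And>t. \<theta> (t + 1) = \<theta> t + 2 * pi * n"
    using angle_function[OF assms] by metis
  have sm: "smooth_fun f" and reg: "\<And>t. D f t \<noteq> 0" and nz: "\<And>t. curv f t \<noteq> 0"
    using assms by (auto simp: rosette_def)
  obtain z where z: "\<theta> 1 - \<theta> 0 = curv f z * cmod (D f z)"
    using MVT2[of 0 1 \<theta> "\<lambda>t. curv f t * cmod (D f t)"] d by auto
  then have "2 * pi * n = curv f z * cmod (D f z)" using per[of 0] by simp
  then have pos: "n > 0 \<and> curv f z > 0"
    using reg[of z] nz[of z]
    by (metis mult_eq_0_iff norm_eq_zero of_nat_0_le_iff gr0I mult_nonneg_nonneg pi_ge_zero zero_le_numeral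
        zero_less_norm_iff of_nat_0 mult_le_0_iff not_le order.antisym)
  then show "n > 0" by simp
  have cont: "continuous_on S (curv f)" for S
    using curv_differentiable(1)[OF sm reg]
    by (intro continuous_at_imp_continuous_on) (simp add: differentiable_imp_continuous_within)
  show "curv f t > 0"
    using pos same_sign_if_no_zero[OF cont _ nz, of z t] same_sign_if_no_zero[OF cont _ nz, of t z]
    by (cases "z \<le> t") auto
qed

section \<open>Branches of parallel pairs\<close>

text \<open>The union of the other sets is a finite union of closed sets, hence closed. A connected
  subset that meets \<open>C i\<close> therefore cannot reach any of them.\<close>

lemma components_finite_disjoint_Union:
  assumes "finite I" and closed: "\<And>i. i \<in> I \<Longrightarrow> closed (C i)"
    and conn: "\<And>i. i \<in> I \<Longrightarrow> connected (C i)" and ne: "\<And>i. i \<in> I \<Longrightarrow> C i \<noteq> {}"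
    and disj: "\<And>i j. i \<in> I \<Longrightarrow> j \<in> I \<Longrightarrow> i \<noteq> j \<Longrightarrow> C i \<inter> C j = {}"
  shows "components (\<Union>i\<in>I. C i) = C ` I"
proof -
  let ?S = "\<Union>i\<in>I. C i"
  have comp: "connected_component_set ?S x = C i" if i: "i \<in> I" and x: "x \<in> C i" for i x
  proof
    show "C i \<subseteq> connected_component_set ?S x"
      by (rule connected_component_maximal) (use i x conn in auto)
    let ?T = "connected_component_set ?S x" and ?R = "\<Union>j\<in>I - {i}. C j"
    have sub: "?T \<subseteq> C i \<union> ?R" using connected_component_subset[of ?S x] by auto
    moreover have dis: "C i \<inter> ?R = {}" using disj i by auto
    moreover have "closed ?R" using assms(1) closed by (intro closed_UN) auto
    moreover have "x \<in> ?T" using i x by (auto intro: connected_component_refl)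
    ultimately have "?R \<inter> ?T = {}"
      using connected_closedD[OF connected_connected_component[of ?S x], of "C i" ?R] closed[OF i] x
      by blast
    then show "?T \<subseteq> C i" using sub by blast
  qed
  show ?thesis
  proof
    show "components ?S \<subseteq> C ` I" using comp by (auto simp: components_def)
    show "C ` I \<subseteq> components ?S"
    proof
      fix T assume "T \<in> C ` I"
      then obtain i where i: "i \<in> I" "T = C i" by auto
      then obtain x where "x \<in> C i" using ne by auto
      then show "T \<in> components ?S" using comp[OF i(1)] i by (auto simp: components_def)
    qed
  qed
qed

lemma ecirc_eq_iff: "ecirc s = ecirc t \<longleftrightarrow> (\<exists>j::int. t = s + of_int j)"
proof -
  have "ecirc s = ecirc t \<longleftrightarrow> sin (2 * pi * t) = sin (2 * pi * s) \<and> cos (2 * pi * t) = cos (2 * pi * s)"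
    by (auto simp: ecirc_def complex_eq_iff)
  also have "\<dots> \<longleftrightarrow> (\<exists>j::int. 2 * pi * t = 2 * pi * s + 2 * pi * of_int j)"
    by (simp add: sin_cos_eq_iff)
  also have "\<dots> \<longleftrightarrow> (\<exists>j::int. t = s + of_int j)"
    by (simp flip: distrib_left)
  finally show ?thesis .
qed

lemma continuous_ecirc: "continuous_on S ecirc"
  unfolding ecirc_def by (intro continuous_intros)

text \<open>Fixing the angle together with its inverse \<open>\<tau>\<close> lets every later
  statement use the tangent angle as the coordinate, in which parallelism is a translation.\<close>

locale angle_param =
  fixes f :: "real \<Rightarrow> complex" and n :: nat and \<theta> \<tau> :: "real \<Rightarrow> real"
  assumes generic: "generic_rosette f n"
    and theta_deriv: "(\<theta> has_real_derivative curv f t * cmod (D f t)) (at t)"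
    and D_polar: "D f t = of_real (cmod (D f t)) * cis (\<theta> t)"
    and theta_shift_1: "\<theta> (t + 1) = \<theta> t + 2 * pi * n"
    and tau_theta [simp]: "\<tau> (\<theta> t) = t"
    and theta_tau [simp]: "\<theta> (\<tau> x) = x"

lemma angle_param_exists:
  assumes "generic_rosette f n"
  obtains \<theta> \<tau> where "angle_param f n \<theta> \<tau>"
proof -
  have ros: "rosette f n" using assms by (simp add: generic_rosette_def)
  obtain \<theta> where d: "\<And>t. (\<theta> has_real_derivative curv f t * cmod (D f t)) (at t)"
    and pol: "\<And>t. D f t = of_real (cmod (D f t)) * cis (\<theta> t)"
    and per: "\<And>t. \<theta> (t + 1) = \<theta> t + 2 * pi * n"
    using angle_function[OF ros] by metis
  have "curv f t * cmod (D f t) > 0" for t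
    using rosette_curv_pos[OF ros] ros by (simp add: rosette_def)
  then have mono: "\<theta> s < \<theta> t" if "s < t" for s t
    using that d by (meson DERIV_pos_imp_increasing)
  then have inj: "inj \<theta>"
    by (metis injI less_irrefl linorder_neqE_linordered_idom)
  have shift: "\<theta> (t + real N) = \<theta> t + 2 * pi * n * N" for t N
  proof (induction N)
    case (Suc N)
    then show ?case using per[of "t + real N"] by (simp add: algebra_simps)
  qed simp
  have "\<exists>t. \<theta> t = x" for x
  proof -
    obtain N where N: "\<bar>x - \<theta> 0\<bar> \<le> real N" using real_arch_simple by blast
    \<comment> \<open>Each period raises the angle by at least \<open>1\<close>, so \<open>N\<close>
      periods to either side of \<open>0\<close> reach every value within distance \<open>N\<close>
      of \<open>\<theta> 0\<close>.\<close>
    have "1 \<le> 2 * pi * real n"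
      using rosette_curv_pos(1)[OF ros] pi_gt3 mult_mono[of 1 "2 * pi" 1 "real n"] by auto
    then have "real N \<le> 2 * pi * n * N" by (metis mult_1 mult_right_mono of_nat_0_le_iff)
    moreover have "\<theta> (real N) = \<theta> 0 + 2 * pi * n * N" "\<theta> 0 = \<theta> (- real N) + 2 * pi * n * N"
      using shift[of 0 N] shift[of "- real N" N] by simp_all
    ultimately have "\<theta> (- real N) \<le> x" "x \<le> \<theta> (real N)"
      using N by linarith+
    moreover have "continuous_on {- real N..real N} \<theta>"
      using d by (meson DERIV_isCont continuous_at_imp_continuous_on)
    ultimately show ?thesis using IVT'[of \<theta> "- real N" x "real N"] by auto
  qed
  then have "surj \<theta>" by (metis surjI)
  with inj have "angle_param f n \<theta> (inv \<theta>)"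
    using assms d pol per by unfold_locales (auto simp: surj_f_inv_f)
  then show ?thesis by (rule that)
qed

section \<open>Curvature and position as functions of the tangent angle\<close>

context angle_param
begin

lemma
  shows smooth: "smooth_fun f" and periodic: "f (t + 1) = f t" and D_nz: "D f t \<noteq> 0"
    and curv_pos: "curv f t > 0" and n_pos: "n > 0"
  using generic rosette_curv_pos[of f n] by (auto simp: generic_rosette_def rosette_def)

text \<open>\<open>K1\<close> and \<open>K2\<close> are derivatives with respect to arc length, not with respect to the angle \<open>x\<close>.\<close>

definition K :: "real \<Rightarrow> real" where "K x = curv f (\<tau> x)"
definition K1 :: "real \<Rightarrow> real" where "K1 x = curv1 f (\<tau> x)"
definition K2 :: "real \<Rightarrow> real" where "K2 x = curv2 f (\<tau> x)"
definition F :: "real \<Rightarrow> complex" where "F x = f (\<tau> x)"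

lemma K_pos: "K x > 0"
  by (simp add: K_def curv_pos)

lemma tau_deriv: "(\<tau> has_real_derivative 1 / (K x * cmod (D f (\<tau> x)))) (at x)"
proof -
  have cont: "isCont \<theta> t" for t
    by (rule DERIV_isCont[OF theta_deriv])
  have "isCont \<tau> (\<theta> (\<tau> x))"
    by (rule isCont_inverse_function[of 1]) (auto intro: cont)
  then have "(\<tau> has_real_derivative inverse (curv f (\<tau> x) * cmod (D f (\<tau> x)))) (at x)"
    using curv_pos[of "\<tau> x"] D_nz[of "\<tau> x"]
    by (intro DERIV_inverse_function[where f = \<theta> and a = "x - 1" and b = "x + 1"] theta_deriv) auto
  then show ?thesis by (simp add: K_def inverse_eq_divide)
qed

text \<open>The angle grows along arc length at rate \<open>K\<close>, so differentiation in the
  angle is the arc length derivative divided by \<open>K\<close>.\<close>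

lemma K_deriv: "(K has_real_derivative K1 x / K x) (at x)"
proof -
  have "(curv f has_real_derivative D (curv f) (\<tau> x)) (at (\<tau> x))"
    unfolding has_real_derivative_iff_has_vector_derivative
    by (intro has_D_if_differentiable curv_differentiable smooth D_nz)
  from DERIV_chain2[OF this tau_deriv] show ?thesis
    by (simp add: K_def[abs_def] K1_def curv1_def arcD_def mult.commute)
qed

lemma K1_deriv: "(K1 has_real_derivative K2 x / K x) (at x)"
proof -
  have "(curv1 f has_real_derivative D (curv1 f) (\<tau> x)) (at (\<tau> x))"
    unfolding has_real_derivative_iff_has_vector_derivative
    by (intro has_D_if_differentiable curv_differentiable smooth D_nz)
  from DERIV_chain2[OF this tau_deriv] show ?thesis
    by (simp add: K_def[abs_def] K1_def[abs_def] K2_def curv2_def curv1_def arcD_def[of f "arcD f (curv f)"] mult.commute)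
qed

lemma F_deriv: "(F has_vector_derivative (1 / K x) *\<^sub>R cis x) (at x)"
proof -
  have "(f \<circ> \<tau> has_vector_derivative (1 / (K x * cmod (D f (\<tau> x)))) *\<^sub>R D f (\<tau> x)) (at x)"
    using tau_deriv[of x] unfolding has_real_derivative_iff_has_vector_derivative
    by (rule vector_diff_chain_at) (rule smooth_fun_has_D[OF smooth])
  also have "D f (\<tau> x) = cmod (D f (\<tau> x)) *\<^sub>R cis x"
    using D_polar[of "\<tau> x"] by (simp add: scaleR_conv_of_real)
  finally show ?thesis using D_nz[of "\<tau> x"] by (simp add: F_def[abs_def] o_def)
qed

lemma theta_shift: "\<theta> (t + of_int j) = \<theta> t + 2 * pi * n * of_int j"
proof -
  \<comment> \<open>Subtracting the linear part \<open>2 * pi * n * t\<close> leaves a function of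
    period \<open>1\<close>.\<close>
  have "\<theta> (t + of_int j * 1) - 2 * pi * n * (t + of_int j * 1) = \<theta> t - 2 * pi * n * t"
    by (rule periodic_int[of "\<lambda>t. \<theta> t - 2 * pi * n * t" 1]) (simp add: theta_shift_1 algebra_simps)
  then show ?thesis by (simp add: algebra_simps)
qed

lemma tau_shift: "\<tau> (x + 2 * pi * n * of_int j) = \<tau> x + of_int j"
  by (metis tau_theta theta_shift theta_tau)

lemma K_shift: "K (x + 2 * pi * n * of_int j) = K x"
proof -
  have per1: "D f (t + 1) = D f t" for t by (rule D_periodic[OF smooth periodic])
  have per2: "D (D f) (t + 1) = D (D f) t" for t by (rule D_periodic[OF smooth_fun_D[OF smooth] per1])
  have "curv f (t + 1) = curv f t" for t by (simp add: curv_def per1 per2)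
  from periodic_int[of "curv f" 1, OF this] show ?thesis by (simp add: K_def tau_shift)
qed

lemma ecirc_eq_iff_theta: "ecirc s = ecirc t \<longleftrightarrow> (\<exists>j::int. \<theta> t = \<theta> s + 2 * pi * n * of_int j)"
  by (metis ecirc_eq_iff tau_theta theta_shift tau_shift)

lemma D_mult_cnj_D: "D f s * cnj (D f t) = of_real (cmod (D f s) * cmod (D f t)) * cis (\<theta> s - \<theta> t)"
proof -
  have "cis (\<theta> s - \<theta> t) = cis (\<theta> s) * cis (- \<theta> t)" by (simp add: cis_mult)
  then show ?thesis
    using arg_cong2[OF D_polar[of s] D_polar[of t], of "\<lambda>a b. a * cnj b"]
    by (simp add: cis_cnj algebra_simps)
qed

text \<open>Tangents are parallel when the sine of the angle difference vanishes. The two points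
  coincide exactly when the difference is a whole number of turns \<open>2 * pi * n\<close>, that is
  when \<open>2 * n\<close> divides \<open>m\<close>.\<close>

lemma parallel_pair_iff:
  "parallel_pair f s t \<longleftrightarrow> (\<exists>m::int. \<theta> t = \<theta> s + of_int m * pi \<and> \<not> 2 * int n dvd m)"
proof -
  have "Im (D f s * cnj (D f t)) = 0 \<longleftrightarrow> sin (\<theta> t - \<theta> s) = 0"
    unfolding D_mult_cnj_D using D_nz[of s] D_nz[of t]
    by (auto simp: sin_diff algebra_simps)
  also have "\<dots> \<longleftrightarrow> (\<exists>m::int. \<theta> t = \<theta> s + of_int m * pi)"
    by (simp add: sin_zero_iff_int2 algebra_simps)
  finally have 1: "Im (D f s * cnj (D f t)) = 0 \<longleftrightarrow> (\<exists>m::int. \<theta> t = \<theta> s + of_int m * pi)" .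
  have 2: "ecirc s = ecirc t \<longleftrightarrow> 2 * int n dvd m" if "\<theta> t = \<theta> s + of_int m * pi" for m :: int
  proof -
    have "of_int m * pi = 2 * pi * n * of_int j \<longleftrightarrow> m = 2 * int n * j" for j
    proof -
      have "of_int m * pi = 2 * pi * n * of_int j \<longleftrightarrow> pi * of_int m = pi * of_int (2 * int n * j)"
        by (simp add: algebra_simps)
      also have "\<dots> \<longleftrightarrow> m = 2 * int n * j" by (simp only: mult_cancel_left pi_neq_zero of_int_eq_iff simp_thms)
      finally show ?thesis .
    qed
    then show ?thesis unfolding ecirc_eq_iff_theta that by (auto simp: dvd_def)
  qed
  show ?thesis unfolding parallel_pair_def 1 using 2 by blast
qed

section \<open>Families of pairs with a fixed angle offset\<close>

definition C :: "int \<Rightarrow> (complex \<times> complex) set" where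
  "C m = range (\<lambda>s. (ecirc s, ecirc (\<tau> (\<theta> s + of_int m * pi))))"

text \<open>A point of the circle fixes its parameter only up to integers, so a pair fixes the
  offset only modulo \<open>2 * n\<close>. Allowing all integers as index makes swapping a change of
  sign of the index.\<close>

lemma mem_C_iff:
  "(ecirc s, ecirc t) \<in> C m \<longleftrightarrow> (\<exists>l::int. \<theta> t = \<theta> s + of_int l * pi \<and> 2 * int n dvd l - m)"
proof
  assume "(ecirc s, ecirc t) \<in> C m"
  then obtain s' where "ecirc s = ecirc s'" "ecirc t = ecirc (\<tau> (\<theta> s' + of_int m * pi))"
    by (auto simp: C_def)
  then obtain i j :: int where "\<theta> s' = \<theta> s + 2 * pi * n * of_int i" "\<theta> s' + of_int m * pi = \<theta> t + 2 * pi * n * of_int j"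
    unfolding ecirc_eq_iff_theta theta_tau by blast
  then have "\<theta> t = \<theta> s + of_int (m + 2 * int n * (i - j)) * pi" by (simp add: algebra_simps)
  then show "\<exists>l::int. \<theta> t = \<theta> s + of_int l * pi \<and> 2 * int n dvd l - m"
    by (intro exI[of _ "m + 2 * int n * (i - j)"]) simp
next
  assume "\<exists>l::int. \<theta> t = \<theta> s + of_int l * pi \<and> 2 * int n dvd l - m"
  then obtain l j where l: "\<theta> t = \<theta> s + of_int l * pi" "l - m = 2 * int n * j" by (auto simp: dvd_def)
  have "real_of_int (l - m) = real_of_int (2 * int n * j)" using l(2) by simp
  then have mreal: "real_of_int m = of_int l - 2 * n * of_int j" by simp
  have "\<theta> s + of_int m * pi = \<theta> t + 2 * pi * n * of_int (- j)"
    unfolding l(1) mreal by (simp add: algebra_simps)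
  then have "ecirc t = ecirc (\<tau> (\<theta> s + of_int m * pi))"
    unfolding ecirc_eq_iff_theta theta_tau by blast
  then show "(ecirc s, ecirc t) \<in> C m" by (auto simp: C_def)
qed

lemma C_elem: "p \<in> C m \<Longrightarrow> \<exists>s t. p = (ecirc s, ecirc t)"
  by (auto simp: C_def)

lemma C_eqI: "2 * int n dvd l - m \<Longrightarrow> C l = C m"
proof -
  assume *: "2 * int n dvd l - m"
  have "2 * int n dvd i - l \<longleftrightarrow> 2 * int n dvd i - m" for i
    using dvd_add_left_iff[OF *, of "i - l"] by simp
  then have "(ecirc s, ecirc t) \<in> C l \<longleftrightarrow> (ecirc s, ecirc t) \<in> C m" for s t
    unfolding mem_C_iff by simp
  then show ?thesis using C_elem by blast
qed

lemma C_disjoint: "C l \<inter> C m = {}" if "\<not> 2 * int n dvd l - m"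
proof (rule ccontr)
  assume "C l \<inter> C m \<noteq> {}"
  then obtain s t where "(ecirc s, ecirc t) \<in> C l" "(ecirc s, ecirc t) \<in> C m"
    using C_elem by blast
  then obtain i j where "\<theta> t = \<theta> s + of_int i * pi" "\<theta> t = \<theta> s + of_int j * pi"
    "2 * int n dvd i - l" "2 * int n dvd j - m" unfolding mem_C_iff by blast
  then have "i = j" "2 * int n dvd (j - m) - (i - l)" by (simp, blast intro: dvd_diff)
  then show False using that by simp
qed

lemma C_nonempty: "C m \<noteq> {}"
  by (simp add: C_def)

lemma continuous_tau: "continuous_on S \<tau>" and continuous_theta: "continuous_on S \<theta>"
  using tau_deriv theta_deriv by (meson DERIV_isCont continuous_at_imp_continuous_on)+

lemma continuous_C_param: "continuous_on S (\<lambda>s. (ecirc s, ecirc (\<tau> (\<theta> s + of_int m * pi))))"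
  by (intro continuous_on_Pair continuous_ecirc continuous_on_compose2[OF continuous_ecirc[of UNIV]]
      continuous_on_compose2[OF continuous_tau[of UNIV]] continuous_intros continuous_theta) auto

lemma connected_C: "connected (C m)"
  unfolding C_def by (intro connected_continuous_image continuous_C_param) simp

text \<open>Raising \<open>s\<close> by \<open>1\<close> raises both parameters of the pair by
  \<open>1\<close>, so one period already gives the whole family as a compact image.\<close>

lemma closed_C: "closed (C m)"
proof -
  have "C m = (\<lambda>s. (ecirc s, ecirc (\<tau> (\<theta> s + of_int m * pi)))) ` {0..1}"
  proof
    show "C m \<subseteq> (\<lambda>s. (ecirc s, ecirc (\<tau> (\<theta> s + of_int m * pi)))) ` {0..1}"
    proof
      fix p assume "p \<in> C m"
      then obtain s where s: "p = (ecirc s, ecirc (\<tau> (\<theta> s + of_int m * pi)))" by (auto simp: C_def)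
      define r where "r = frac s"
      have seq: "s = r + of_int \<lfloor>s\<rfloor>" by (simp add: r_def frac_def)
      have "\<tau> (\<theta> s + of_int m * pi) = \<tau> (\<theta> r + of_int m * pi) + of_int \<lfloor>s\<rfloor>"
        using arg_cong[OF seq, of \<theta>] unfolding theta_shift tau_shift[symmetric] by (simp add: algebra_simps)
      then have "ecirc (\<tau> (\<theta> s + of_int m * pi)) = ecirc (\<tau> (\<theta> r + of_int m * pi))" "ecirc s = ecirc r"
        using seq ecirc_eq_iff by metis+
      then show "p \<in> (\<lambda>s. (ecirc s, ecirc (\<tau> (\<theta> s + of_int m * pi)))) ` {0..1}"
        using s frac_ge_0[of s] frac_lt_1[of s] by (intro image_eqI[of _ _ r]) (auto simp: r_def)
    qed
  qed (auto simp: C_def)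
  then have "compact (C m)" using compact_continuous_image[OF continuous_C_param] by (metis compact_Icc)
  then show ?thesis by (rule compact_imp_closed)
qed

lemma swap_C: "prod.swap ` C m = C (- m)"
proof -
  have sub: "prod.swap ` C m \<subseteq> C (- m)" for m
  proof
    fix p assume "p \<in> prod.swap ` C m"
    then obtain s t where st: "p = (ecirc t, ecirc s)" "(ecirc s, ecirc t) \<in> C m"
      using C_elem by force
    then obtain l where "\<theta> t = \<theta> s + of_int l * pi" "2 * int n dvd l - m" unfolding mem_C_iff by blast
    then have "\<theta> s = \<theta> t + of_int (- l) * pi \<and> 2 * int n dvd (- l) - (- m)"
      using dvd_minus_iff[of "2 * int n" "l - m"] by simp
    then show "p \<in> C (- m)" unfolding st(1) mem_C_iff by blast
  qed
  \<comment> \<open>Swapping is an involution, so the inclusion for \<open>- m\<close> yields the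
    reverse one for \<open>m\<close>.\<close>
  have "C (- m) = prod.swap ` prod.swap ` C (- m)" by (simp add: image_comp)
  also have "\<dots> \<subseteq> prod.swap ` C m" using sub[of "- m"] by (intro image_mono) simp
  finally show ?thesis using sub[of m] by blast
qed

lemma dvd_range: "2 * int n dvd l - m \<longleftrightarrow> l = m" if "l \<in> {1..2 * int n - 1}" "m \<in> {1..2 * int n - 1}"
proof
  assume "2 * int n dvd l - m"
  then show "l = m" using that zdvd_imp_le[of "2 * int n" "l - m"] zdvd_imp_le[of "2 * int n" "m - l"]
    by (cases l m rule: linorder_cases) (auto simp: dvd_diff_commute)
qed simp

lemma components_pp_set: "components (pp_set f) = C ` {1..2 * int n - 1}"
proof -
  let ?I = "{1..2 * int n - 1}"
  have "pp_set f = (\<Union>m\<in>?I. C m)"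
  proof (intro equalityI subsetI)
    fix p assume "p \<in> pp_set f"
    then obtain s t m where p: "p = (ecirc s, ecirc t)" and m: "\<theta> t = \<theta> s + of_int m * pi" "\<not> 2 * int n dvd m"
      unfolding pp_set_def parallel_pair_iff by blast
    have "m mod (2 * int n) \<noteq> 0" using m(2) by (simp add: dvd_eq_mod_eq_0)
    moreover have "0 \<le> m mod (2 * int n)" "m mod (2 * int n) < 2 * int n" using n_pos by simp_all
    ultimately have "m mod (2 * int n) \<in> ?I" by simp
    moreover have "p \<in> C (m mod (2 * int n))"
      unfolding p mem_C_iff using m by (intro exI[of _ m]) (simp add: minus_mod_eq_mult_div)
    ultimately show "p \<in> (\<Union>m\<in>?I. C m)" by blast
  next
    fix p assume "p \<in> (\<Union>m\<in>?I. C m)"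
    then obtain m where m: "m \<in> ?I" "p \<in> C m" by blast
    then obtain s t where p: "p = (ecirc s, ecirc t)" using C_elem by blast
    from m(2) obtain l where l: "\<theta> t = \<theta> s + of_int l * pi" "2 * int n dvd l - m"
      unfolding p mem_C_iff by blast
    have "\<not> 2 * int n dvd m" using m(1) zdvd_imp_le[of "2 * int n" m] by auto
    then have "\<not> 2 * int n dvd l" using l(2) by (metis dvd_diff_right_iff)
    then show "p \<in> pp_set f" unfolding pp_set_def parallel_pair_iff using p l(1) by blast
  qed
  then show ?thesis
    using components_finite_disjoint_Union[of ?I C, OF _ closed_C connected_C C_nonempty C_disjoint] dvd_range
    by simp
qed

definition B :: "int \<Rightarrow> (complex \<times> complex) set" where
  "B k = C k \<union> C (- k)"

lemma branches_eq: "branches f = B ` {1..int n}"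
proof -
  have "branches f = B ` {1..2 * int n - 1}"
  proof -
    have "branches f = (\<lambda>S. S \<union> prod.swap ` S) ` components (pp_set f)"
      unfolding branches_def by blast
    then show ?thesis unfolding components_pp_set image_image swap_C B_def .
  qed
  also have "\<dots> = B ` {1..int n}"
  proof
    show "B ` {1..2 * int n - 1} \<subseteq> B ` {1..int n}"
    proof
      fix S assume "S \<in> B ` {1..2 * int n - 1}"
      then obtain k where k: "k \<in> {1..2 * int n - 1}" "S = B k" by blast
      \<comment> \<open>The offset \<open>2 * n - k\<close> is congruent to \<open>- k\<close>, so
        indices above \<open>n\<close> repeat earlier branches.\<close>
      have "B k = B (2 * int n - k)"
        unfolding B_def using C_eqI[of "2 * int n - k" "- k"] C_eqI[of "- (2 * int n - k)" k] by auto
      then show "S \<in> B ` {1..int n}"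
        using k by (cases "k \<le> int n") auto
    qed
  qed auto
  finally show ?thesis .
qed

text \<open>Within \<open>{1..int n}\<close> a congruence of \<open>k\<close> and \<open>- l\<close>
  forces \<open>k + l\<close> to be at least \<open>2 * n\<close>, hence \<open>k\<close> and
  \<open>l\<close> are both \<open>n\<close>.\<close>

lemma inj_on_B: "inj_on B {1..int n}"
proof (rule inj_onI)
  fix k l assume kl: "k \<in> {1..int n}" "l \<in> {1..int n}" "B k = B l"
  then have "C k \<subseteq> C l \<union> C (- l)" by (auto simp: B_def)
  then have "2 * int n dvd k - l \<or> 2 * int n dvd k - (- l)"
    using C_disjoint[of k l] C_disjoint[of k "- l"] C_nonempty[of k] by blast
  then show "k = l"
  proof
    assume "2 * int n dvd k - (- l)"
    then have "2 * int n \<le> k + l" using kl zdvd_imp_le[of "2 * int n" "k + l"] by auto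
    then show ?thesis using kl by auto
  qed (use dvd_range[of k l] kl in auto)
qed

lemma card_branches_filter:
  "card {S \<in> branches f. P S} = card {k \<in> {1..int n}. P (B k)}"
proof -
  have "{S \<in> branches f. P S} = B ` {k \<in> {1..int n}. P (B k)}" by (auto simp: branches_eq)
  moreover have "inj_on B {k \<in> {1..int n}. P (B k)}"
    by (rule inj_on_subset[OF inj_on_B]) blast
  ultimately show ?thesis by (simp only: card_image)
qed

end

section \<open>Velocities of the centre symmetry set and the Wigner caustic\<close>

abbreviation parity_sign :: "int \<Rightarrow> real" where
  "parity_sign m \<equiv> if even m then 1 else -1"

context angle_param
begin

text \<open>The logarithm turns an exchange of the two points into a change of sign. It also makes
  the angle derivative a difference of the terms \<open>K1 / K ^ 2\<close>, the quantity that
  genericity compares at the two points.\<close>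

definition G :: "int \<Rightarrow> real \<Rightarrow> real" where
  "G m y = ln (K (y + of_int m * pi)) - ln (K y)"

definition G1 :: "int \<Rightarrow> real \<Rightarrow> real" where
  "G1 m y = K1 (y + of_int m * pi) / K (y + of_int m * pi) ^ 2 - K1 y / K y ^ 2"

definition G2 :: "int \<Rightarrow> real \<Rightarrow> real" where
  "G2 m y = (K2 (y + of_int m * pi) / K (y + of_int m * pi) ^ 3 - 2 * (K1 (y + of_int m * pi) / K (y + of_int m * pi) ^ 2)\<^sup>2)
    - (K2 y / K y ^ 3 - 2 * (K1 y / K y ^ 2)\<^sup>2)"

lemma G_deriv: "(G m has_real_derivative G1 m y) (at y)"
proof -
  have ln_K: "((\<lambda>y. ln (K y)) has_real_derivative K1 y / K y ^ 2) (at y)" for y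
    using K_pos[of y] by (auto intro!: derivative_eq_intros K_deriv simp: power2_eq_square)
  have "((\<lambda>y. y + of_int m * pi) has_real_derivative 1) (at y)"
    by (auto intro!: derivative_eq_intros)
  from DERIV_diff[OF DERIV_chain2[OF ln_K this] ln_K] show ?thesis
    by (simp add: G_def[abs_def] G1_def)
qed

lemma G1_deriv: "(G1 m has_real_derivative G2 m y) (at y)"
proof -
  have slope: "((\<lambda>y. K1 y / K y ^ 2) has_real_derivative K2 y / K y ^ 3 - 2 * (K1 y / K y ^ 2)\<^sup>2) (at y)" for y
    using K_pos[of y]
    by (auto intro!: derivative_eq_intros K_deriv K1_deriv simp: field_simps power2_eq_square power3_eq_cube)
  have "((\<lambda>y. y + of_int m * pi) has_real_derivative 1) (at y)"
    by (auto intro!: derivative_eq_intros)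
  from DERIV_diff[OF DERIV_chain2[OF slope this] slope] show ?thesis
    by (simp add: G1_def[abs_def] G2_def)
qed

lemma parallel_pair_tau:
  assumes "\<not> 2 * int n dvd m"
  shows "parallel_pair f (\<tau> y) (\<tau> (y + of_int m * pi))"
  unfolding parallel_pair_iff theta_tau using assms by blast

lemma tsgn_eq: "tsgn f s t = sgn (cos (\<theta> t - \<theta> s))"
  unfolding tsgn_def D_mult_cnj_D using D_nz[of s] D_nz[of t]
  by (simp add: sgn_mult cos_diff mult.commute)

lemma ksum_eq:
  assumes "\<theta> t = \<theta> s + of_int m * pi"
  shows "ksum f s t = K (\<theta> s) - parity_sign m * K (\<theta> s + of_int m * pi)"
proof -
  have "tsgn f s t = parity_sign m"
    unfolding tsgn_eq assms by (simp add: mult.commute[of _ pi])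
  then show ?thesis unfolding ksum_def by (simp add: K_def flip: assms)
qed

text \<open>A parallel pair with equal positions would be a tangential self-crossing.\<close>

lemma F_neq:
  assumes "\<not> 2 * int n dvd m"
  shows "F y \<noteq> F (y + of_int m * pi)"
  using parallel_pair_tau[OF assms, of y] generic
  unfolding parallel_pair_def generic_rosette_def F_def by metis

text \<open>At a zero of \<open>G1\<close> the squared terms of \<open>G2\<close> cancel. A double
  zero would thus make both \<open>K1 / K ^ 2\<close> and \<open>K2 / K ^ 3\<close> agree at the
  pair, against the non-degeneracy condition on second derivatives.\<close>

lemma G1_simple:
  assumes m: "\<not> 2 * int n dvd m" and 0: "G1 m y = 0"
  shows "G2 m y \<noteq> 0"
proof
  assume G2: "G2 m y = 0"
  define z where "z = y + of_int m * pi"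
  have pos: "K y > 0" "K z > 0" by (rule K_pos)+
  have slope: "K1 y / K y ^ 2 = K1 z / K z ^ 2" using 0 by (simp add: G1_def z_def)
  then have "K2 y / K y ^ 3 = K2 z / K z ^ 3" using G2 unfolding G2_def z_def[symmetric] by simp
  then have "K1 y * K z ^ 2 = K y ^ 2 * K1 z" "K2 y * K z ^ 3 = K y ^ 3 * K2 z"
    using slope pos by (simp_all add: field_simps)
  then show False
    using parallel_pair_tau[OF m, of y] generic
    unfolding generic_rosette_def K_def K1_def K2_def z_def by blast
qed

text \<open>For even \<open>m\<close> the tangents point the same way, so a zero of \<open>G\<close>
  is a pair with vanishing \<open>ksum\<close>; there genericity forbids the equality expressed by
  \<open>G1 m y = 0\<close>.\<close>

lemma G_simple:
  assumes m: "\<not> 2 * int n dvd m" and "even m" and 0: "G m y = 0"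
  shows "G1 m y \<noteq> 0"
proof
  assume G1: "G1 m y = 0"
  define z where "z = y + of_int m * pi"
  have pos: "K y > 0" "K z > 0" by (rule K_pos)+
  have "K z = K y" using 0 pos unfolding G_def z_def[symmetric] by simp
  then have "ksum f (\<tau> y) (\<tau> z) = 0"
    using ksum_eq[of "\<tau> z" "\<tau> y" m] \<open>even m\<close> by (simp add: z_def)
  moreover have "K1 y / K y ^ 2 = K1 z / K z ^ 2" using G1 by (simp add: G1_def z_def)
  then have "K1 y * K z ^ 2 = K y ^ 2 * K1 z" using pos by (simp add: field_simps)
  ultimately show False
    using parallel_pair_tau[OF m, of y] generic
    unfolding generic_rosette_def K_def K1_def z_def by blast
qed

lemma cis_shift: "cis (x + of_int m * pi) = parity_sign m *\<^sub>R cis x"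
proof -
  have "cis (of_int m * pi) = of_real (parity_sign m)"
    by (simp add: complex_eq_iff mult.commute[of _ pi])
  then show ?thesis by (simp add: cis_mult[symmetric])
qed

lemma K_comp_deriv:
  assumes "(A has_real_derivative c) (at u)"
  shows "((\<lambda>v. K (A v)) has_real_derivative c * (K1 (A u) / K (A u))) (at u)"
  using DERIV_chain2[OF K_deriv assms] by (simp add: mult.commute)

lemma F_comp_deriv:
  assumes "(A has_real_derivative c) (at u)"
  shows "((\<lambda>v. F (A v)) has_vector_derivative (c / K (A u)) *\<^sub>R cis (A u)) (at u)"
  using vector_diff_chain_at[OF assms[unfolded has_real_derivative_iff_has_vector_derivative] F_deriv]
  by (simp add: o_def)

text \<open>The pair is parallel only at \<open>u\<close>: a traversal is unconstrained outside \<open>{0..1}\<close>, while \<open>D\<close> is the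
  two-sided derivative also at the end points.\<close>

lemma css_deriv:
  assumes A: "((\<lambda>v. \<theta> (s v)) has_real_derivative c) (at u)"
    and B: "((\<lambda>v. \<theta> (t v)) has_real_derivative c) (at u)"
    and par: "\<theta> (t u) = \<theta> (s u) + of_int m * pi"
    and nz: "ksum f (s u) (t u) \<noteq> 0"
  obtains r where "r \<noteq> 0"
    "((\<lambda>v. css f (s v) (t v)) has_vector_derivative (r * c * G1 m (\<theta> (s u))) *\<^sub>R (f (t u) - f (s u))) (at u)"
proof -
  define e where "e = parity_sign m"
  define a where "a v = \<theta> (s v)" for v
  define b where "b v = \<theta> (t v)" for v
  define M where "M v = K (a v) - e * K (b v)" for v
  define N where "N v = K (a v) *\<^sub>R F (a v) - (e * K (b v)) *\<^sub>R F (b v)" for v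
  have ee: "e * e = 1" "sgn e = e" by (simp_all add: e_def)
  have da: "(a has_real_derivative c) (at u)" and db: "(b has_real_derivative c) (at u)"
    using A B by (simp_all add: a_def[abs_def] b_def[abs_def])
  have fa: "F (a v) = f (s v)" and fb: "F (b v) = f (t v)" for v
    by (simp_all add: a_def b_def F_def)
  have Mu: "M u \<noteq> 0"
    using nz ksum_eq[OF par] by (simp add: M_def a_def b_def par e_def)
  have posa: "K (a u) > 0" and posb: "K (b u) > 0" by (rule K_pos)+
  \<comment> \<open>The sign in the definition of \<open>css\<close> is locally constant: near
    \<open>u\<close> the angle difference stays close to a multiple of \<open>pi\<close>, even if
    the pair is no longer parallel. Hence \<open>css\<close> agrees near \<open>u\<close> with the
    smooth quotient of \<open>N\<close> by \<open>M\<close>.\<close>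
  have "isCont (\<lambda>v. e * cos (b v - a v)) u"
    by (intro continuous_intros DERIV_isCont[OF da] DERIV_isCont[OF db])
  moreover have "e * cos (b u - a u) > 0"
    by (simp add: a_def b_def par e_def mult.commute[of _ pi])
  ultimately have "\<forall>\<^sub>F v in nhds u. e * cos (b v - a v) > 0"
    unfolding eventually_nhds_conv_at by (auto simp: isCont_def intro: order_tendstoD(1))
  then have ev: "\<forall>\<^sub>F v in nhds u. css f (s v) (t v) = (1 / M v) *\<^sub>R N v"
  proof eventually_elim
    case (elim v)
    then have "sgn (e * cos (b v - a v)) = 1" by simp
    then have "e * tsgn f (s v) (t v) = 1"
      unfolding tsgn_eq sgn_mult ee by (simp add: a_def b_def)
    then have "tsgn f (s v) (t v) = e" by (auto simp: e_def split: if_splits)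
    then show ?case
      by (simp add: css_def Let_def M_def N_def fa fb scaleR_conv_of_real divide_inverse)
        (simp add: K_def a_def b_def mult.commute)
  qed
  have dM: "(M has_real_derivative c * (K1 (a u) / K (a u)) - e * (c * (K1 (b u) / K (b u)))) (at u)"
    unfolding M_def by (intro DERIV_diff DERIV_cmult K_comp_deriv da db)
  have dN: "(N has_vector_derivative (c * (K1 (a u) / K (a u))) *\<^sub>R F (a u)
      - (e * (c * (K1 (b u) / K (b u)))) *\<^sub>R F (b u)) (at u)"
  proof -
    have "(N has_vector_derivative
       (K (a u) *\<^sub>R (c / K (a u)) *\<^sub>R cis (a u) + (c * (K1 (a u) / K (a u))) *\<^sub>R F (a u))
       - ((e * K (b u)) *\<^sub>R (c / K (b u)) *\<^sub>R cis (b u) + (e * (c * (K1 (b u) / K (b u)))) *\<^sub>R F (b u))) (at u)"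
      unfolding N_def
      by (intro has_vector_derivative_diff has_vector_derivative_scaleR DERIV_cmult K_comp_deriv F_comp_deriv da db)
    \<comment> \<open>The tangential terms cancel: the weights \<open>K\<close> offset the factors
      \<open>1 / K\<close> in the velocities of the two points, and the tangents differ only by the
      sign \<open>e\<close>.\<close>
    moreover have "cis (b u) = e *\<^sub>R cis (a u)" using cis_shift[of "a u" m] by (simp add: a_def b_def par e_def)
    ultimately show ?thesis
      using posa posb ee by (simp add: mult.assoc[symmetric] mult.commute[of c])
  qed
  define r where "r = - (e * K (a u) * K (b u)) / (M u)\<^sup>2"
  have "((\<lambda>v. (1 / M v) *\<^sub>R N v) has_vector_derivative (r * c * G1 m (a u)) *\<^sub>R (F (b u) - F (a u))) (at u)"
  proof -
    define ka kb k1a k1b where "ka = K (a u)" and "kb = K (b u)" and "k1a = K1 (a u)" and "k1b = K1 (b u)"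
    have dinv: "((\<lambda>v. 1 / M v) has_real_derivative
        - (c * (k1a / ka) - e * (c * (k1b / kb))) / (M u)\<^sup>2) (at u)"
      using DERIV_inverse_fun[OF dM Mu] unfolding inverse_eq_divide ka_def kb_def k1a_def k1b_def
      by (rule DERIV_cong) (simp add: numeral_2_eq_2 diff_divide_distrib)
    have G1: "G1 m (a u) = k1b / kb\<^sup>2 - k1a / ka\<^sup>2"
      by (simp add: G1_def ka_def kb_def k1a_def k1b_def a_def b_def par)
    have MM: "M u = ka - e * kb" by (simp add: M_def ka_def kb_def)
    have M2: "(M u)\<^sup>2 \<noteq> 0" using Mu by simp
    have pos: "ka > 0" "kb > 0" using posa posb by (simp_all add: ka_def kb_def)
    \<comment> \<open>The coefficients of the two positions turn out to be opposite, which makes the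
      velocity a multiple of the chord. Both are verified after multiplying by the nonzero square of
      \<open>M u\<close>.\<close>
    have ca: "(c * (k1a / ka)) / M u - (c * (k1a / ka) - e * (c * (k1b / kb))) / (M u)\<^sup>2 * ka = - (r * c * G1 m (a u))"
    proof -
      have "((c * (k1a / ka)) / M u - (c * (k1a / ka) - e * (c * (k1b / kb))) / (M u)\<^sup>2 * ka) * (M u)\<^sup>2
        = (c * (k1a / ka)) * M u - (c * (k1a / ka) - e * (c * (k1b / kb))) * ka"
        using Mu by (simp add: field_simps power2_eq_square)
      also have "\<dots> = e * c * (ka * k1b / kb - kb * k1a / ka)"
        using pos by (simp add: MM field_simps)
      also have "\<dots> = - (r * c * G1 m (a u)) * (M u)\<^sup>2"
        using pos Mu unfolding r_def G1 ka_def[symmetric] kb_def[symmetric] by (simp add: field_simps power2_eq_square)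
      finally show ?thesis unfolding mult_right_cancel[OF M2] .
    qed
    have cb: "- (e * (c * (k1b / kb))) / M u + (c * (k1a / ka) - e * (c * (k1b / kb))) / (M u)\<^sup>2 * (e * kb) = r * c * G1 m (a u)"
    proof -
      have "(- (e * (c * (k1b / kb))) / M u + (c * (k1a / ka) - e * (c * (k1b / kb))) / (M u)\<^sup>2 * (e * kb)) * (M u)\<^sup>2
        = - (e * (c * (k1b / kb))) * M u + (c * (k1a / ka) - e * (c * (k1b / kb))) * (e * kb)"
        using Mu by (simp add: field_simps power2_eq_square)
      also have "\<dots> = e * c * (kb * k1a / ka - ka * k1b / kb)"
        using pos by (simp add: MM field_simps)
      also have "\<dots> = r * c * G1 m (a u) * (M u)\<^sup>2"
        using pos Mu unfolding r_def G1 ka_def[symmetric] kb_def[symmetric] by (simp add: field_simps power2_eq_square)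
      finally show ?thesis unfolding mult_right_cancel[OF M2] .
    qed
    have collect: "(1 / M0) *\<^sub>R (p *\<^sub>R A - q *\<^sub>R B) + (- d / M1) *\<^sub>R (x *\<^sub>R A - y *\<^sub>R B)
        = (p / M0 - d / M1 * x) *\<^sub>R A + (- q / M0 + d / M1 * y) *\<^sub>R B"
      for p q d x y M0 M1 :: real and A B :: complex
      by (simp add: divide_inverse algebra_simps)
    have "((\<lambda>v. (1 / M v) *\<^sub>R N v) has_vector_derivative
        (1 / M u) *\<^sub>R ((c * (k1a / ka)) *\<^sub>R F (a u) - (e * (c * (k1b / kb))) *\<^sub>R F (b u))
        + (- (c * (k1a / ka) - e * (c * (k1b / kb))) / (M u)\<^sup>2) *\<^sub>R N u) (at u)"
      by (rule has_vector_derivative_scaleR[OF dinv])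
        (use dN in \<open>simp add: ka_def kb_def k1a_def k1b_def\<close>)
    also have "(1 / M u) *\<^sub>R ((c * (k1a / ka)) *\<^sub>R F (a u) - (e * (c * (k1b / kb))) *\<^sub>R F (b u))
        + (- (c * (k1a / ka) - e * (c * (k1b / kb))) / (M u)\<^sup>2) *\<^sub>R N u
      = ((c * (k1a / ka)) / M u - (c * (k1a / ka) - e * (c * (k1b / kb))) / (M u)\<^sup>2 * ka) *\<^sub>R F (a u)
        + (- (e * (c * (k1b / kb))) / M u + (c * (k1a / ka) - e * (c * (k1b / kb))) / (M u)\<^sup>2 * (e * kb)) *\<^sub>R F (b u)"
      unfolding N_def ka_def[symmetric] kb_def[symmetric] by (rule collect)
    also have "\<dots> = (r * c * G1 m (a u)) *\<^sub>R (F (b u) - F (a u))"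
      unfolding ca cb by (simp add: scaleR_diff_right)
    finally show ?thesis .
  qed
  then have "((\<lambda>v. css f (s v) (t v)) has_vector_derivative (r * c * G1 m (a u)) *\<^sub>R (F (b u) - F (a u))) (at u)"
    using ev eventually_nhds_x_imp_x[OF ev]
    by (subst has_vector_derivative_cong_ev[where g = "\<lambda>v. (1 / M v) *\<^sub>R N v"]) (auto elim: eventually_mono)
  moreover have "r \<noteq> 0" using posa posb Mu by (simp add: r_def e_def)
  ultimately show ?thesis using that by (simp add: fa fb) (simp add: a_def)
qed

text \<open>For odd \<open>m\<close> the tangents are opposite, so the velocities of the two points
  subtract and leave the difference of the radii of curvature.\<close>

lemma wigner_deriv:
  assumes A: "((\<lambda>v. \<theta> (s v)) has_real_derivative c) (at u)"
    and B: "((\<lambda>v. \<theta> (t v)) has_real_derivative c) (at u)"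
    and par: "\<theta> (t u) = \<theta> (s u) + of_int m * pi" and "odd m"
  shows "((\<lambda>v. wigner f (s v) (t v)) has_vector_derivative
    (c / 2 * (1 / K (\<theta> (s u)) - 1 / K (\<theta> (s u) + of_int m * pi))) *\<^sub>R cis (\<theta> (s u))) (at u)"
proof -
  have "(\<lambda>v. wigner f (s v) (t v)) = (\<lambda>v. (1 / 2) *\<^sub>R (F (\<theta> (s v)) + F (\<theta> (t v))))"
    by (simp add: wigner_def F_def scaleR_conv_of_real)
  moreover have "((\<lambda>v. (1 / 2) *\<^sub>R (F (\<theta> (s v)) + F (\<theta> (t v)))) has_vector_derivative
    (1 / 2) *\<^sub>R ((c / K (\<theta> (s u))) *\<^sub>R cis (\<theta> (s u)) + (c / K (\<theta> (t u))) *\<^sub>R cis (\<theta> (t u)))) (at u)"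
    by (intro bounded_linear.has_vector_derivative[OF bounded_linear_scaleR_right]
        has_vector_derivative_add F_comp_deriv A B)
  moreover have "cis (\<theta> (t u)) = - cis (\<theta> (s u))"
    unfolding par cis_shift using \<open>odd m\<close> by simp
  ultimately show ?thesis
    by (simp add: par algebra_simps diff_divide_distrib)
qed

end

section \<open>Traversals\<close>

text \<open>An injective continuous \<open>X\<close> is monotone, so it sends \<open>{0..<1}\<close>
  onto one half-open period, closed on the left if \<open>X\<close> increases and on the right if it
  decreases.\<close>

lemma card_zeros_reparametrized:
  fixes X :: "real \<Rightarrow> real"
  assumes cont: "continuous_on {0..1} X" and inj: "inj_on X {0..1}" and len: "\<bar>X 1 - X 0\<bar> = L"
    and L: "L > 0" and per: "\<And>y. P (y + L) \<longleftrightarrow> P y"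
  shows "card {u \<in> {0..<1}. P (X u)} = card {y \<in> {c..<c + L}. P y}"
proof -
  have between: "(X 0 < X u \<and> X u < X 1) \<or> (X 1 < X u \<and> X u < X 0)" if "0 < u" "u < 1" for u
    by (rule continuous_inj_imp_mono[OF that cont inj])
  have "card {u \<in> {0..<1}. P (X u)} = card {y \<in> X ` {0..<1}. P y}"
  proof -
    have "{y \<in> X ` {0..<1}. P y} = X ` {u \<in> {0..<1}. P (X u)}" by auto
    moreover have "inj_on X {u \<in> {0..<1}. P (X u)}" by (rule inj_on_subset[OF inj]) auto
    ultimately show ?thesis by (simp only: card_image)
  qed
  also have "\<dots> = card {y \<in> {c..<c + L}. P y}"
  proof (cases "X 0 < X 1")
    case True
    have "X ` {0..<1} = {X 0..<X 0 + L}"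
    proof (intro equalityI subsetI)
      fix y assume "y \<in> X ` {0..<1}"
      then obtain u where "0 \<le> u" "u < 1" "y = X u" by auto
      then show "y \<in> {X 0..<X 0 + L}" using between[of u] True len by (cases "u = 0") auto
    next
      fix y assume y: "y \<in> {X 0..<X 0 + L}"
      then obtain u where "0 \<le> u" "u \<le> 1" "X u = y"
        using IVT'[of X 0 y 1] cont True len by auto
      then show "y \<in> X ` {0..<1}" using y True len by (cases "u = 1") auto
    qed
    then show ?thesis using card_periodic_Ico[of L P, OF L per] by metis
  next
    case False
    then have X10: "X 1 < X 0" "X 0 = X 1 + L" using len L by auto
    have "X ` {0..<1} = {X 1<..X 1 + L}"
    proof (intro equalityI subsetI)
      fix y assume "y \<in> X ` {0..<1}"
      then obtain u where "0 \<le> u" "u < 1" "y = X u" by auto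
      then show "y \<in> {X 1<..X 1 + L}" using between[of u] X10 by (cases "u = 0") auto
    next
      fix y assume y: "y \<in> {X 1<..X 1 + L}"
      then obtain u where "0 \<le> u" "u \<le> 1" "X u = y"
        using IVT2'[of X 1 y 0] cont X10 by auto
      then show "y \<in> X ` {0..<1}" using y X10 by (cases "u = 1") auto
    qed
    then show ?thesis using card_periodic_Ico[of L P, OF L per] card_periodic_Ioc[of L P, OF L per] by metis
  qed
  finally show ?thesis .
qed

context angle_param
begin

text \<open>The angle swept by a traversal of \<open>B k\<close>: the family \<open>B n\<close> is invariant under swapping, so
  half a turn already exhausts its unordered pairs.\<close>

definition len :: "int \<Rightarrow> real" where
  "len k = (if k = int n then pi * n else 2 * pi * n)"

text \<open>The factor gained by \<open>G\<close>, \<open>G1\<close> and the chord when the angle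
  advances by \<open>len k\<close>.\<close>

definition monodromy :: "int \<Rightarrow> real" where
  "monodromy k = (if k = int n then -1 else 1)"

text \<open>Both signs occur because a traversal may run through the ordered pairs of a branch in
  either order.\<close>

definition in_branch :: "int \<Rightarrow> int \<Rightarrow> bool" where
  "in_branch k m \<longleftrightarrow> 2 * int n dvd m - k \<or> 2 * int n dvd m + k"

lemma len_pos: "len k > 0"
  using n_pos by (simp add: len_def)

lemma in_branch_not_dvd:
  assumes "k \<in> {1..int n}" "in_branch k m"
  shows "\<not> 2 * int n dvd m"
proof
  assume *: "2 * int n dvd m"
  then have "2 * int n dvd k"
    using assms(2) dvd_add_right_iff[OF *, of k] dvd_diff_right_iff[OF *, of k] by (auto simp: in_branch_def)
  then show False using zdvd_imp_le[of "2 * int n" k] assms(1) by auto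
qed

lemma in_branch_n:
  assumes "in_branch (int n) m"
  obtains j where "m = int n + 2 * int n * j"
proof -
  have "2 * int n dvd m - int n"
    using assms dvd_diff[of "2 * int n" "m + int n" "2 * int n"] by (auto simp: in_branch_def)
  then obtain j where "m - int n = 2 * int n * j" by (auto simp: dvd_def)
  then show ?thesis using that[of j] by simp
qed

lemma in_branch_even_iff: "in_branch k m \<Longrightarrow> even m \<longleftrightarrow> even k"
  unfolding in_branch_def by (metis dvd_mult_left even_add even_diff)

lemma mem_B_iff:
  "(ecirc s, ecirc t) \<in> B k \<longleftrightarrow> (\<exists>m::int. \<theta> t = \<theta> s + of_int m * pi \<and> in_branch k m)"
  unfolding B_def Un_iff mem_C_iff in_branch_def by auto

text \<open>For \<open>k = n\<close> an advance by \<open>pi * n\<close> carries each point of the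
  pair to the other one up to whole turns, which reverses the sign of the difference of
  logarithms.\<close>

lemma G_quasiperiodic:
  assumes "in_branch k m"
  shows "G m (y + len k) = monodromy k * G m y"
proof (cases "k = int n")
  case True
  with assms obtain j where j: "m = int n + 2 * int n * j" using in_branch_n by blast
  have "K (y + pi * n + of_int m * pi) = K (y + 2 * pi * n * of_int (j + 1))"
    unfolding j by (simp add: algebra_simps)
  moreover have "K (y + of_int m * pi) = K (y + pi * n + 2 * pi * n * of_int j)"
    unfolding j by (simp add: algebra_simps)
  ultimately show ?thesis
    using True unfolding G_def K_shift by (simp add: len_def monodromy_def G_def)
next
  case False
  have "K (y + 2 * pi * n) = K y" "K (y + 2 * pi * n + of_int m * pi) = K (y + of_int m * pi)"
    using K_shift[of y 1] K_shift[of "y + of_int m * pi" 1] by (simp_all add: algebra_simps)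
  then show ?thesis using False by (simp add: G_def len_def monodromy_def)
qed

lemma G1_quasiperiodic:
  assumes "in_branch k m"
  shows "G1 m (y + len k) = monodromy k * G1 m y"
proof -
  have "((\<lambda>y. y + len k) has_real_derivative 1) (at y)" by (auto intro!: derivative_eq_intros)
  from DERIV_chain2[OF G_deriv this]
  have "((\<lambda>y. G m (y + len k)) has_real_derivative G1 m (y + len k)) (at y)" by simp
  then have "((\<lambda>y. monodromy k * G m y) has_real_derivative G1 m (y + len k)) (at y)"
    unfolding G_quasiperiodic[OF assms] .
  then show ?thesis using DERIV_cmult[OF G_deriv[of m y], of "monodromy k"] DERIV_unique by blast
qed

lemma ecirc_pair_eq_if:
  assumes "\<theta> s = \<theta> s' + 2 * pi * n * of_int j" "\<theta> t = \<theta> s + of_int m * pi" "\<theta> t' = \<theta> s' + of_int m * pi"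
  shows "(ecirc s, ecirc t) = (ecirc s', ecirc t')"
proof -
  have "\<theta> t = \<theta> t' + 2 * pi * n * of_int j" using assms by simp
  then have "ecirc s' = ecirc s" "ecirc t' = ecirc t" using assms(1) ecirc_eq_iff_theta by blast+
  then show ?thesis by simp
qed

text \<open>Here \<open>m\<close> is an odd multiple of \<open>n\<close>, so applying the offset
  twice gives whole turns and the second point of the new pair is the first point of the old
  one.\<close>

lemma ecirc_pair_swap_if:
  assumes "\<theta> s = \<theta> s' + of_int m * pi + 2 * pi * n * of_int j" "in_branch (int n) m"
    "\<theta> t = \<theta> s + of_int m * pi" "\<theta> t' = \<theta> s' + of_int m * pi"
  shows "(ecirc s, ecirc t) = prod.swap (ecirc s', ecirc t')"
proof -
  obtain i where i: "m = int n + 2 * int n * i" using in_branch_n[OF assms(2)] by blast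
  have "\<theta> s = \<theta> t' + 2 * pi * n * of_int j" using assms by simp
  moreover have "\<theta> t = \<theta> s' + 2 * pi * n * of_int (j + 1 + 2 * i)"
    unfolding assms(1,3) by (simp add: i algebra_simps)
  ultimately have "ecirc t' = ecirc s" "ecirc s' = ecirc t" using ecirc_eq_iff_theta by blast+
  then show ?thesis by simp
qed

text \<open>\<open>trav\<close> is an arbitrary choice, so the counts must hold for every traversal.
  This reduces any of them to an injective sweep of the angle over exactly \<open>len k\<close> with
  constant offset.\<close>

lemma traversal_angle:
  assumes k: "k \<in> {1..int n}" and trav: "traversal f (B k) \<gamma>"
  obtains m where "in_branch k m"
    "\<And>u. u \<in> {0..1} \<Longrightarrow> \<theta> (snd (\<gamma> u)) = \<theta> (fst (\<gamma> u)) + of_int m * pi"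
    "\<And>u. u \<in> {0..1} \<Longrightarrow> \<exists>c. c \<noteq> 0 \<and> ((\<lambda>v. \<theta> (fst (\<gamma> v))) has_real_derivative c) (at u)
        \<and> ((\<lambda>v. \<theta> (snd (\<gamma> v))) has_real_derivative c) (at u)"
    "inj_on (\<lambda>u. \<theta> (fst (\<gamma> u))) {0..1}"
    "\<bar>\<theta> (fst (\<gamma> 1)) - \<theta> (fst (\<gamma> 0))\<bar> = len k"
proof -
  define X where "X u = \<theta> (fst (\<gamma> u))" for u
  define Y where "Y u = \<theta> (snd (\<gamma> u))" for u
  define P where "P u = (ecirc (fst (\<gamma> u)), ecirc (snd (\<gamma> u)))" for u
  have diff: "\<gamma> differentiable (at u)" "D \<gamma> u \<noteq> 0" "P u \<in> B k" if "u \<in> {0..1}" for u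
    using trav that by (auto simp: traversal_def Let_def P_def)
  have close: "P 1 = P 0 \<or> P 1 = prod.swap (P 0)"
    and inj_P: "\<And>u v. u \<in> {0..<1} \<Longrightarrow> v \<in> {0..<1} \<Longrightarrow> u \<noteq> v \<Longrightarrow> P u \<noteq> P v \<and> P u \<noteq> prod.swap (P v)"
    using trav unfolding traversal_def Let_def P_def by blast+
  define dx where "dx u = curv f (fst (\<gamma> u)) * cmod (D f (fst (\<gamma> u))) * fst (D \<gamma> u)" for u
  define dy where "dy u = curv f (snd (\<gamma> u)) * cmod (D f (snd (\<gamma> u))) * snd (D \<gamma> u)" for u
  have dX: "(X has_real_derivative dx u) (at u)" and dY: "(Y has_real_derivative dy u) (at u)" if "u \<in> {0..1}" for u
  proof -
    have "(\<gamma> has_vector_derivative D \<gamma> u) (at u)" by (rule has_D_if_differentiable[OF diff(1)[OF that]])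
    then have fs: "((\<lambda>v. fst (\<gamma> v)) has_real_derivative fst (D \<gamma> u)) (at u)"
      "((\<lambda>v. snd (\<gamma> v)) has_real_derivative snd (D \<gamma> u)) (at u)"
      unfolding has_real_derivative_iff_has_vector_derivative
      by (rule bounded_linear.has_vector_derivative[OF bounded_linear_fst]
          bounded_linear.has_vector_derivative[OF bounded_linear_snd])+
    show "(X has_real_derivative dx u) (at u)" "(Y has_real_derivative dy u) (at u)"
      unfolding X_def[abs_def] Y_def[abs_def] dx_def dy_def
      using DERIV_chain2[OF theta_deriv fs(1)] DERIV_chain2[OF theta_deriv fs(2)] by simp_all
  qed
  have contX: "continuous_on {0..1} X" and contY: "continuous_on {0..1} Y"
    using dX dY by (meson DERIV_isCont continuous_at_imp_continuous_on)+
  have ex_m: "\<exists>m::int. Y u = X u + of_int m * pi \<and> in_branch k m" if "u \<in> {0..1}" for u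
    using diff(3)[OF that] unfolding P_def mem_B_iff X_def Y_def .
  \<comment> \<open>A continuous function with integer values on an interval is constant.\<close>
  have "(\<lambda>u. (Y u - X u) / pi) constant_on {0..1}"
  proof (rule continuous_discrete_range_constant)
    show "\<exists>e>0. \<forall>v. v \<in> {0..1} \<and> (Y v - X v) / pi \<noteq> (Y u - X u) / pi \<longrightarrow>
        e \<le> norm ((Y v - X v) / pi - (Y u - X u) / pi)" if u: "u \<in> {0..1}" for u
    proof (intro exI[of _ 1] conjI allI impI)
      fix v assume v: "v \<in> {0..1} \<and> (Y v - X v) / pi \<noteq> (Y u - X u) / pi"
      obtain i j :: int where "(Y u - X u) / pi = of_int i" "(Y v - X v) / pi = of_int j"
        using ex_m[OF u] ex_m[of v] v by fastforce
      then show "1 \<le> norm ((Y v - X v) / pi - (Y u - X u) / pi)" using v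
        by (simp flip: of_int_diff of_int_abs) linarith
    qed simp
  qed (auto intro!: continuous_intros contX contY)
  then obtain q where q: "\<And>u. u \<in> {0..1} \<Longrightarrow> (Y u - X u) / pi = q" by (auto simp: constant_on_def)
  obtain m where m: "Y 0 = X 0 + of_int m * pi" "in_branch k m" using ex_m[of 0] by auto
  have YX: "Y u = X u + of_int m * pi" if "u \<in> {0..1}" for u
    using q[OF that] q[of 0] m(1) by (simp add: field_simps)
  \<comment> \<open>The offset is constant only on \<open>{0..1}\<close>, so the derivatives are
    compared within that interval; at the end points this is one-sided.\<close>
  have dxy: "dy u = dx u" if u: "u \<in> {0..1}" for u
  proof (rule vector_derivative_unique_within_closed_interval)
    show "(Y has_vector_derivative dy u) (at u within cbox 0 1)"
      using dY[OF u] by (simp add: has_real_derivative_iff_has_vector_derivative has_vector_derivative_at_within)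
    have "((\<lambda>u. X u + of_int m * pi) has_real_derivative dx u) (at u)"
      using dX[OF u] by (auto intro!: derivative_eq_intros)
    then have "((\<lambda>u. X u + of_int m * pi) has_vector_derivative dx u) (at u within {0..1})"
      by (simp add: has_real_derivative_iff_has_vector_derivative has_vector_derivative_at_within)
    then show "(Y has_vector_derivative dx u) (at u within cbox 0 1)"
      unfolding cbox_interval by (rule has_vector_derivative_transform[OF u, rotated]) (use YX in auto)
  qed (use u in auto)
  have dx_nz: "dx u \<noteq> 0" if u: "u \<in> {0..1}" for u
  proof
    assume "dx u = 0"
    moreover have "dy u = 0" using dxy[OF u] calculation by simp
    ultimately have "D \<gamma> u = 0"
      using curv_pos[of "fst (\<gamma> u)"] curv_pos[of "snd (\<gamma> u)"] D_nz
      by (auto simp: dx_def dy_def prod_eq_iff)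
    then show False using diff(2)[OF u] by simp
  qed
  have injX: "inj_on X {0..1}"
  proof (rule linorder_inj_onI)
    fix u v :: real assume uv: "u < v" "u \<in> {0..1}" "v \<in> {0..1}"
    show "X u \<noteq> X v"
    proof
      assume "X u = X v"
      moreover have "continuous_on {u..v} X" by (rule continuous_on_subset[OF contX]) (use uv in auto)
      moreover have "\<And>x. u < x \<Longrightarrow> x < v \<Longrightarrow> X differentiable (at x)"
      proof -
        fix x assume "u < x" "x < v"
        then have "x \<in> {0..1}" using uv by auto
        from dX[OF this] show "X differentiable (at x)" using real_differentiable_def by blast
      qed
      ultimately obtain z where z: "u < z" "z < v" "(X has_real_derivative 0) (at z)"
        using Rolle[OF uv(1)] by blast
      then have "z \<in> {0..1}" using uv by auto
      then show False using dX[of z] dx_nz[of z] z(3) DERIV_unique by blast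
    qed
  qed auto
  have P_eq: "P u = P v" if "u \<in> {0..1}" "v \<in> {0..1}" "X u = X v + 2 * pi * n * of_int j" for u v j
    unfolding P_def by (rule ecirc_pair_eq_if[of _ _ j _ m]) (use that YX in \<open>auto simp: X_def Y_def\<close>)
  \<comment> \<open>Two angles that differ by a multiple of \<open>len k\<close> give the same pair
    or, for \<open>k = n\<close> and an odd multiple, the swapped pair. A traversal repeats neither
    before its end.\<close>
  have not_multiple: "X u \<noteq> X v + len k * of_int j" if u: "u \<in> {0..<1}" and v: "v \<in> {0..<1}" and ne: "u \<noteq> v" for u v j
  proof
    assume eq: "X u = X v + len k * of_int j"
    show False
    proof (cases "k = int n \<and> odd j")
      case False
      have "\<exists>i::int. X u = X v + 2 * pi * n * of_int i"
      proof (cases "k = int n")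
        case True
        then obtain i where "j = 2 * i" using False by auto
        then show ?thesis using eq True by (intro exI[of _ i]) (simp add: len_def)
      qed (use eq in \<open>auto simp: len_def\<close>)
      then show False using P_eq[of u v] inj_P[OF u v ne] u v by auto
    next
      case True
      then obtain i where i: "j = 2 * i + 1" by (auto elim: oddE)
      obtain l where l: "m = int n + 2 * int n * l" using m(2) True in_branch_n by blast
      have "X u = X v + of_int m * pi + 2 * pi * n * of_int (i - l)"
        unfolding eq using True by (simp add: len_def i l algebra_simps)
      then have "P u = prod.swap (P v)"
        unfolding P_def using m(2) True u v
        by (intro ecirc_pair_swap_if[of _ _ m "i - l"]) (use YX in \<open>auto simp: X_def Y_def\<close>)
      then show False using inj_P[OF u v ne] by simp
    qed
  qed
  have "\<exists>j::int. X 1 = X 0 + len k * of_int j"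
    using close
  proof
    assume "P 1 = P 0"
    then have "ecirc (fst (\<gamma> 0)) = ecirc (fst (\<gamma> 1))" by (simp add: P_def)
    then obtain j :: int where j: "X 1 = X 0 + 2 * pi * n * of_int j"
      unfolding ecirc_eq_iff_theta X_def by blast
    show ?thesis
      by (cases "k = int n") (use j in \<open>auto simp: len_def intro: exI[of _ "2 * j"] exI[of _ j]\<close>)
  next
    assume "P 1 = prod.swap (P 0)"
    then have "ecirc (snd (\<gamma> 0)) = ecirc (fst (\<gamma> 1))" "ecirc (fst (\<gamma> 0)) = ecirc (snd (\<gamma> 1))" by (simp_all add: P_def)
    then obtain i j :: int where ij: "X 1 = Y 0 + 2 * pi * n * of_int j" "Y 1 = X 0 + 2 * pi * n * of_int i"
      unfolding ecirc_eq_iff_theta X_def Y_def by blast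
    \<comment> \<open>Comparing both closing relations shows that \<open>n\<close> divides
      \<open>m\<close>, and hence \<open>k\<close>; only the branch with \<open>k = n\<close> can
      close up by a swap.\<close>
    then have "pi * of_int m = pi * of_int (int n * (i - j))"
      using YX[of 0] YX[of 1] by (simp add: algebra_simps)
    then have mij: "m = int n * (i - j)" by (simp only: mult_cancel_left pi_neq_zero of_int_eq_iff simp_thms)
    then have "int n dvd m" by simp
    moreover have "int n dvd m - k \<or> int n dvd m + k"
      using m(2) unfolding in_branch_def by (meson dvd_mult_right)
    ultimately have "int n dvd k" by (metis dvd_add_right_iff dvd_diff_right_iff)
    then have "k = int n" using k zdvd_imp_le[of "int n" k] by auto
    then have "X 1 = X 0 + len k * of_int (i + j)"
      using ij(1) YX[of 0] mij by (simp add: len_def algebra_simps)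
    then show ?thesis by blast
  qed
  then obtain j :: int where j: "X 1 = X 0 + len k * of_int j" by blast
  have "X 1 \<noteq> X 0" using inj_onD[OF injX, of 1 0] by auto
  then have "j \<noteq> 0" using j by auto
  \<comment> \<open>A longer sweep would pass a point at distance \<open>len k\<close> from the
    start before time \<open>1\<close>, repeating the initial pair or its swap.\<close>
  have "\<bar>X 1 - X 0\<bar> \<le> len k"
  proof (rule ccontr)
    assume gt: "\<not> ?thesis"
    have "\<exists>u\<in>{0..1}. \<exists>i::int. i \<noteq> 0 \<and> X u = X 0 + len k * of_int i \<and> X u \<noteq> X 1"
    proof (cases "X 0 < X 1")
      case True
      then obtain u where "0 \<le> u" "u \<le> 1" "X u = X 0 + len k"
        using IVT'[of X 0 "X 0 + len k" 1] contX gt len_pos[of k] by auto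
      then show ?thesis using gt True by (intro bexI[of _ u] exI[of _ 1]) auto
    next
      case False
      then obtain u where "0 \<le> u" "u \<le> 1" "X u = X 0 - len k"
        using IVT2'[of X 1 "X 0 - len k" 0] contX gt len_pos[of k] by auto
      then show ?thesis using gt False by (intro bexI[of _ u] exI[of _ "-1"]) auto
    qed
    then obtain u i where u: "u \<in> {0..1}" "i \<noteq> 0" "X u = X 0 + len k * of_int i" "X u \<noteq> X 1" by blast
    then have "u \<in> {0..<1}" "u \<noteq> 0" using len_pos[of k] by (auto simp: less_le)
    then show False using not_multiple[of u 0 i] u(3) by simp
  qed
  moreover have "\<bar>X 1 - X 0\<bar> \<ge> len k"
  proof -
    have "1 \<le> \<bar>real_of_int j\<bar>" using \<open>j \<noteq> 0\<close> by (simp flip: of_int_abs)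
    then show ?thesis using j len_pos[of k] by (simp add: abs_mult)
  qed
  ultimately have "\<bar>X 1 - X 0\<bar> = len k" by simp
  moreover have "\<exists>c. c \<noteq> 0 \<and> (X has_real_derivative c) (at u) \<and> (Y has_real_derivative c) (at u)" if "u \<in> {0..1}" for u
    using dX[OF that] dY[OF that] dxy[OF that] dx_nz[OF that] by auto
  ultimately show ?thesis
    using that[of m] m(2) YX injX unfolding X_def[abs_def] Y_def[abs_def] by blast
qed

text \<open>The first parameter runs linearly from \<open>0\<close> to the value \<open>E\<close> at
  which the angle has grown by \<open>len k\<close>, and the second point follows at offset
  \<open>k * pi\<close>.\<close>

lemma traversal_exists:
  assumes k: "k \<in> {1..int n}"
  shows "\<exists>\<gamma>. traversal f (B k) \<gamma>"
proof -
  define E where "E = \<tau> (\<theta> 0 + len k)"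
  define \<gamma> where "\<gamma> u = (E * u, \<tau> (\<theta> (E * u) + of_int k * pi))" for u
  define P where "P u = (ecirc (fst (\<gamma> u)), ecirc (snd (\<gamma> u)))" for u
  define X where "X u = \<theta> (E * u)" for u
  have mono: "\<theta> s < \<theta> t" if "s < t" for s t
  proof (rule DERIV_pos_imp_increasing[OF that])
    fix x
    have "curv f x * cmod (D f x) > 0" using curv_pos[of x] D_nz[of x] by simp
    then show "\<exists>y. (\<theta> has_real_derivative y) (at x) \<and> 0 < y" using theta_deriv[of x] by blast
  qed
  have thE: "\<theta> E = \<theta> 0 + len k" by (simp add: E_def)
  have E_pos: "E > 0"
    using mono[of E 0] thE len_pos[of k] by (cases E "0::real" rule: linorder_cases) auto
  have X01: "X 0 = \<theta> 0" "X 1 = \<theta> 0 + len k" by (simp_all add: X_def thE)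
  have X_mono: "X u < X v" if "u < v" for u v using mono that E_pos by (simp add: X_def)
  have Y: "\<theta> (snd (\<gamma> u)) = X u + of_int k * pi" and Xf: "\<theta> (fst (\<gamma> u)) = X u" for u
    by (simp_all add: \<gamma>_def X_def)
  have kk: "in_branch k k" by (simp add: in_branch_def)
  have diff: "\<gamma> differentiable (at u) \<and> D \<gamma> u \<noteq> 0" for u
  proof -
    have 1: "((\<lambda>u. E * u) has_real_derivative E) (at u)" by (auto intro!: derivative_eq_intros)
    have "((\<lambda>u. \<theta> (E * u) + of_int k * pi) has_real_derivative curv f (E * u) * cmod (D f (E * u)) * E) (at u)"
      using DERIV_chain2[OF theta_deriv 1] by (auto intro!: derivative_eq_intros)
    from DERIV_chain2[OF tau_deriv this] obtain d where
      "((\<lambda>u. \<tau> (\<theta> (E * u) + of_int k * pi)) has_real_derivative d) (at u)" by blast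
    with 1 have "(\<gamma> has_vector_derivative (E, d)) (at u)"
      unfolding \<gamma>_def has_real_derivative_iff_has_vector_derivative by (rule has_vector_derivative_Pair)
    then show ?thesis using E_pos D_eqI[of \<gamma> "(E, d)" u]
      by (auto intro: differentiableI_vector simp: zero_prod_def)
  qed
  have PB: "P u \<in> B k" for u
    unfolding P_def mem_B_iff Y Xf using kk by blast
  have close: "P 1 = P 0 \<or> P 1 = prod.swap (P 0)"
  proof (cases "k = int n")
    case True
    have "P 1 = prod.swap (P 0)"
      unfolding P_def by (rule ecirc_pair_swap_if[of _ _ k 0]) (use True kk in \<open>simp_all add: Y Xf X01 len_def\<close>)
    then show ?thesis ..
  next
    case False
    have "P 1 = P 0"
      unfolding P_def by (rule ecirc_pair_eq_if[of _ _ 1 _ k]) (use False in \<open>simp_all add: Y Xf X01 len_def\<close>)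
    then show ?thesis ..
  qed
  have inj1: "P u \<noteq> P v \<and> P u \<noteq> prod.swap (P v)" if u: "u \<in> {0..<1}" and v: "v \<in> {0..<1}" and ne: "u \<noteq> v" for u v
  proof -
    have bd: "X 0 \<le> X w \<and> X w < X 1" if "w \<in> {0..<1}" for w
      using X_mono[of 0 w] X_mono[of w 1] that by (cases "w = 0") auto
    have neX: "X u \<noteq> X v" using X_mono[of u v] X_mono[of v u] ne by (cases u v rule: linorder_cases) auto
    have lt: "\<bar>X u - X v\<bar> < len k" using bd[OF u] bd[OF v] X01 by auto
    have le: "len k \<le> 2 * pi * n" using n_pos by (simp add: len_def)
    have "P u \<noteq> P v"
    proof
      assume "P u = P v"
      then have "ecirc (fst (\<gamma> v)) = ecirc (fst (\<gamma> u))" by (simp add: P_def)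
      then obtain j :: int where j: "X u = X v + 2 * pi * n * of_int j"
        unfolding ecirc_eq_iff_theta Xf by blast
      then have "j \<noteq> 0" using neX by auto
      then have "1 \<le> \<bar>real_of_int j\<bar>" by (simp flip: of_int_abs)
      then have "2 * pi * n * 1 \<le> 2 * pi * n * \<bar>real_of_int j\<bar>" by (intro mult_left_mono) auto
      then have "2 * pi * n \<le> \<bar>X u - X v\<bar>" unfolding j by (simp add: abs_mult)
      then show False using lt le by simp
    qed
    moreover have "P u \<noteq> prod.swap (P v)"
    proof
      assume "P u = prod.swap (P v)"
      then have "ecirc (snd (\<gamma> v)) = ecirc (fst (\<gamma> u))" "ecirc (fst (\<gamma> v)) = ecirc (snd (\<gamma> u))" by (simp_all add: P_def)
      then obtain i j :: int where ij: "X u = X v + of_int k * pi + 2 * pi * n * of_int j"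
        "X u + of_int k * pi = X v + 2 * pi * n * of_int i"
        unfolding ecirc_eq_iff_theta Xf Y by blast
      then have "pi * of_int k = pi * of_int (int n * (i - j))" by (simp add: algebra_simps)
      then have kij: "k = int n * (i - j)" by (simp only: mult_cancel_left pi_neq_zero of_int_eq_iff simp_thms)
      then have "int n dvd k" by simp
      then have kn: "k = int n" using k zdvd_imp_le[of "int n" k] by auto
      then have eq: "X u = X v + pi * n * of_int (1 + 2 * j)" using ij(1) by (simp add: algebra_simps)
      have "1 \<le> \<bar>1 + 2 * j\<bar>" by presburger
      then have "1 \<le> \<bar>real_of_int (1 + 2 * j)\<bar>" by linarith
      then have "pi * n * 1 \<le> pi * n * \<bar>real_of_int (1 + 2 * j)\<bar>" by (intro mult_left_mono) auto
      then have "pi * n \<le> \<bar>X u - X v\<bar>" unfolding eq by (simp add: abs_mult del: of_int_add of_int_mult)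
      then show False using lt kn by (simp add: len_def)
    qed
    ultimately show ?thesis by simp
  qed
  have cover: "B k \<subseteq> P ` {0..1} \<union> prod.swap ` P ` {0..1}"
  proof -
    have C_sub: "C k \<subseteq> P ` {0..1} \<union> prod.swap ` P ` {0..1}"
    proof
      fix p assume "p \<in> C k"
      then obtain s where p: "p = (ecirc s, ecirc (\<tau> (\<theta> s + of_int k * pi)))" by (auto simp: C_def)
      \<comment> \<open>The angle of \<open>s\<close> is reduced modulo \<open>len k\<close>. For
        \<open>k = n\<close> the parity of the quotient \<open>i\<close> decides between the
        traversed pair and its swap.\<close>
      define i where "i = \<lfloor>(\<theta> s - \<theta> 0) / len k\<rfloor>"
      define x where "x = \<theta> s - of_int i * len k"
      have x: "\<theta> 0 \<le> x" "x < \<theta> 0 + len k"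
        using floor_divide_lower[OF len_pos[of k], of "\<theta> s - \<theta> 0"] floor_divide_upper[OF len_pos[of k], of "\<theta> s - \<theta> 0"]
        by (auto simp: x_def i_def algebra_simps)
      have "continuous_on {0..1} X" unfolding X_def
        by (intro continuous_on_compose2[OF continuous_theta[of UNIV]] continuous_intros) auto
      then obtain u where u: "0 \<le> u" "u \<le> 1" "X u = x" using IVT'[of X 0 x 1] X01 x by auto
      have sx: "\<theta> s = x + of_int i * len k" by (simp add: x_def)
      show "p \<in> P ` {0..1} \<union> prod.swap ` P ` {0..1}"
      proof (cases "k = int n \<and> odd i")
        case False
        have "\<exists>l::int. of_int i * len k = 2 * pi * n * of_int l"
        proof (cases "k = int n")
          case True
          then obtain l where "i = 2 * l" using False by auto
          then show ?thesis using True by (intro exI[of _ l]) (simp add: len_def)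
        qed (auto simp: len_def)
        then obtain l :: int where "\<theta> s = x + 2 * pi * n * of_int l" using sx by auto
        then have "p = P u"
          unfolding p P_def by (intro ecirc_pair_eq_if[of _ _ l _ k]) (simp_all add: Y Xf u(3))
        then show ?thesis using u by auto
      next
        case True
        then obtain l where "i = 2 * l + 1" by (auto elim: oddE)
        then have "\<theta> s = x + of_int k * pi + 2 * pi * n * of_int l"
          using sx True by (simp add: len_def algebra_simps)
        then have "p = prod.swap (P u)"
          unfolding p P_def using True kk by (intro ecirc_pair_swap_if[of _ _ k l]) (simp_all add: Y Xf u(3))
        then show ?thesis using u by auto
      qed
    qed
    have "C (- k) = prod.swap ` C k" by (simp add: swap_C)
    also have "\<dots> \<subseteq> prod.swap ` (P ` {0..1} \<union> prod.swap ` P ` {0..1})" using C_sub by (rule image_mono)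
    also have "\<dots> = P ` {0..1} \<union> prod.swap ` P ` {0..1}" by (auto simp: image_Un image_image)
    finally show ?thesis using C_sub by (simp add: B_def)
  qed
  show ?thesis
    using diff PB close inj1 cover unfolding traversal_def Let_def P_def by (intro exI[of _ \<gamma>]) blast
qed

end

section \<open>Cusps, asymptotes and rotation numbers\<close>

lemma cos_2pi_eq_1_iff: "cos (2 * pi * x) = 1 \<longleftrightarrow> x \<in> \<int>"
proof -
  have "cos (2 * pi * x) = 1 \<longleftrightarrow> (\<exists>j::int. 2 * pi * x = of_int j * 2 * pi)"
    by (simp add: cos_one_2pi_int)
  also have "\<dots> \<longleftrightarrow> (\<exists>j::int. x = of_int j)" by auto
  finally show ?thesis by (auto elim: Ints_cases)
qed

lemma cos_2pi_eq_minus_1_iff: "cos (2 * pi * x) = -1 \<longleftrightarrow> x - 1/2 \<in> \<int>"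
proof -
  have "cos (2 * pi * (x - 1/2)) = - cos (2 * pi * x)"
    using cos_minus_pi[of "2 * pi * x"] by (simp add: right_diff_distrib)
  then show ?thesis using cos_2pi_eq_1_iff[of "x - 1/2"] by auto
qed

lemma card_even_int_Icc: "card {k \<in> {1..int n}. even k} = n div 2"
proof -
  have "{k \<in> {1..int n}. even k} = (\<lambda>j. 2 * j) ` {1..int (n div 2)}"
  proof (intro equalityI subsetI)
    fix k assume "k \<in> {k \<in> {1..int n}. even k}"
    then obtain j where "k = 2 * j" "1 \<le> 2 * j" "2 * j \<le> int n" by (auto elim: evenE)
    then show "k \<in> (\<lambda>j. 2 * j) ` {1..int (n div 2)}" by (auto simp: zdiv_int)
  qed (auto simp: zdiv_int)
  then show ?thesis by (simp add: card_image inj_on_def)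
qed

context angle_param
begin

lemma monodromy_cases: "monodromy k = 1 \<or> monodromy k = -1"
  by (simp add: monodromy_def)

lemma ksum_eq_0_iff:
  assumes "\<theta> t = \<theta> s + of_int m * pi"
  shows "ksum f s t = 0 \<longleftrightarrow> even m \<and> G m (\<theta> s) = 0"
  unfolding ksum_eq[OF assms] G_def
  using K_pos[of "\<theta> s"] K_pos[of "\<theta> s + of_int m * pi"] by auto

text \<open>Along a traversal the angle velocity \<open>c\<close> and the chord are nonzero, so a
  velocity vanishes exactly with its scalar factor. The angle then serves as the counting variable
  over one period.\<close>

lemma cusp_cards:
  assumes k: "k \<in> {1..int n}" and trav: "traversal f (B k) \<gamma>"
  obtains m where "in_branch k m"
    "\<And>c. card (css_cusps f \<gamma>) = card {y \<in> {c..<c + len k}. G1 m y = 0}"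
    "\<And>c. odd m \<Longrightarrow> card (wc_cusps f \<gamma>) = card {y \<in> {c..<c + len k}. G m y = 0}"
proof -
  obtain m where m: "in_branch k m"
    and par: "\<And>u. u \<in> {0..1} \<Longrightarrow> \<theta> (snd (\<gamma> u)) = \<theta> (fst (\<gamma> u)) + of_int m * pi"
    and der: "\<And>u. u \<in> {0..1} \<Longrightarrow> \<exists>c. c \<noteq> 0 \<and> ((\<lambda>v. \<theta> (fst (\<gamma> v))) has_real_derivative c) (at u)
        \<and> ((\<lambda>v. \<theta> (snd (\<gamma> v))) has_real_derivative c) (at u)"
    and inj: "inj_on (\<lambda>u. \<theta> (fst (\<gamma> u))) {0..1}"
    and length: "\<bar>\<theta> (fst (\<gamma> 1)) - \<theta> (fst (\<gamma> 0))\<bar> = len k"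
    using traversal_angle[OF k trav] by metis
  have nd: "\<not> 2 * int n dvd m" by (rule in_branch_not_dvd[OF k m])
  have cont: "continuous_on {0..1} (\<lambda>u. \<theta> (fst (\<gamma> u)))"
    using der by (meson DERIV_isCont continuous_at_imp_continuous_on)
  have "css_cusps f \<gamma> = {u \<in> {0..<1}. G1 m (\<theta> (fst (\<gamma> u))) = 0}"
  proof -
    have "(ksum f (fst (\<gamma> u)) (snd (\<gamma> u)) \<noteq> 0 \<and> D (\<lambda>v. css f (fst (\<gamma> v)) (snd (\<gamma> v))) u = 0)
        \<longleftrightarrow> G1 m (\<theta> (fst (\<gamma> u))) = 0" if "u \<in> {0..<1}" for u
    proof -
      have u: "u \<in> {0..1}" using that by simp
      obtain c where c: "c \<noteq> 0" "((\<lambda>v. \<theta> (fst (\<gamma> v))) has_real_derivative c) (at u)"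
        "((\<lambda>v. \<theta> (snd (\<gamma> v))) has_real_derivative c) (at u)" using der[OF u] by blast
      show ?thesis
      proof (cases "ksum f (fst (\<gamma> u)) (snd (\<gamma> u)) = 0")
        case True
        \<comment> \<open>Asymptote parameters are excluded from the cusps by definition; they are
          not zeros of \<open>G1\<close> either, since the zeros of \<open>G\<close> are
          simple.\<close>
        then show ?thesis using ksum_eq_0_iff[OF par[OF u]] G_simple[OF nd] by auto
      next
        case False
        obtain r where "r \<noteq> 0" "((\<lambda>v. css f (fst (\<gamma> v)) (snd (\<gamma> v))) has_vector_derivative
            (r * c * G1 m (\<theta> (fst (\<gamma> u)))) *\<^sub>R (f (snd (\<gamma> u)) - f (fst (\<gamma> u)))) (at u)"
          using css_deriv[OF c(2,3) par[OF u] False] by blast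
        moreover have "f (snd (\<gamma> u)) \<noteq> f (fst (\<gamma> u))"
          using F_neq[OF nd, of "\<theta> (fst (\<gamma> u))"] par[OF u, symmetric] by (auto simp: F_def)
        ultimately show ?thesis using False c(1) by (auto dest: D_eqI)
      qed
    qed
    then show ?thesis unfolding css_cusps_def by blast
  qed
  moreover have "wc_cusps f \<gamma> = {u \<in> {0..<1}. G m (\<theta> (fst (\<gamma> u))) = 0}" if "odd m"
  proof -
    have "D (\<lambda>v. wigner f (fst (\<gamma> v)) (snd (\<gamma> v))) u = 0 \<longleftrightarrow> G m (\<theta> (fst (\<gamma> u))) = 0" if "u \<in> {0..<1}" for u
    proof -
      have u: "u \<in> {0..1}" using that by simp
      obtain c where c: "c \<noteq> 0" "((\<lambda>v. \<theta> (fst (\<gamma> v))) has_real_derivative c) (at u)"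
        "((\<lambda>v. \<theta> (snd (\<gamma> v))) has_real_derivative c) (at u)" using der[OF u] by blast
      show ?thesis
        unfolding D_eqI[OF wigner_deriv[OF c(2,3) par[OF u] \<open>odd m\<close>]] G_def
        using c(1) K_pos[of "\<theta> (fst (\<gamma> u))"] K_pos[of "\<theta> (fst (\<gamma> u)) + of_int m * pi"] by auto
    qed
    then show ?thesis unfolding wc_cusps_def by blast
  qed
  moreover have per: "G m (y + len k) = 0 \<longleftrightarrow> G m y = 0" "G1 m (y + len k) = 0 \<longleftrightarrow> G1 m y = 0" for y
    unfolding G_quasiperiodic[OF m] G1_quasiperiodic[OF m] using monodromy_cases[of k] by auto
  ultimately show ?thesis
    by (intro that[OF m]) (simp_all only: simp_thms
        card_zeros_reparametrized[where P = "\<lambda>y. G m y = 0", OF cont inj length len_pos per(1)]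
        card_zeros_reparametrized[where P = "\<lambda>y. G1 m y = 0", OF cont inj length len_pos per(2)])
qed

lemma odd_css_cusps_iff:
  assumes k: "k \<in> {1..int n}" and trav: "traversal f (B k) \<gamma>"
  shows "odd (card (css_cusps f \<gamma>)) \<longleftrightarrow> k = int n"
proof -
  obtain m where m: "in_branch k m" "\<And>c. card (css_cusps f \<gamma>) = card {y \<in> {c..<c + len k}. G1 m y = 0}"
    by (rule cusp_cards[OF assms]) blast
  have "even (card {y \<in> {0..<0 + len k}. G1 m y = 0}) \<longleftrightarrow> monodromy k = 1"
    by (rule simple_zeros_parity_quasiperiodic[OF G1_deriv G1_simple[OF in_branch_not_dvd[OF k m(1)]] len_pos
          G1_quasiperiodic[OF m(1)] monodromy_cases])
  then show ?thesis unfolding m(2)[of 0] by (simp add: monodromy_def)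
qed

lemma wc_cusps_le_css_cusps:
  assumes k: "k \<in> {1..int n}" and trav: "traversal f (B k) \<gamma>" and "odd k"
  shows "card (wc_cusps f \<gamma>) \<le> card (css_cusps f \<gamma>)"
proof -
  obtain m where m: "in_branch k m" "\<And>c. card (css_cusps f \<gamma>) = card {y \<in> {c..<c + len k}. G1 m y = 0}"
    "\<And>c. odd m \<Longrightarrow> card (wc_cusps f \<gamma>) = card {y \<in> {c..<c + len k}. G m y = 0}"
    by (rule cusp_cards[OF k trav]) blast
  have nd: "\<not> 2 * int n dvd m" by (rule in_branch_not_dvd[OF k m(1)])
  have "odd m" using in_branch_even_iff[OF m(1)] \<open>odd k\<close> by simp
  moreover have "card {y \<in> {0..<0 + len k}. G m y = 0} \<le> card {y \<in> {0..<0 + len k}. G1 m y = 0}"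
    by (rule Rolle_card_quasiperiodic[OF G_deriv simple_zeros_finite[OF G1_deriv G1_simple[OF nd]] len_pos])
      (use G_quasiperiodic[OF m(1)] G1_quasiperiodic[OF m(1)] monodromy_cases[of k] in auto)
  ultimately show ?thesis using m(2,3) by metis
qed

text \<open>Without a zero \<open>G k\<close> would have constant sign, so \<open>ln (K x)\<close>
  would be strictly monotone along the multiples of \<open>k * pi\<close>. After
  \<open>2 * n\<close> steps the angle has advanced by \<open>k\<close> whole turns and the value
  must return.\<close>

lemma G_has_zero: "\<exists>y. G k y = 0"
proof (rule ccontr)
  assume no: "\<nexists>y. G k y = 0"
  have cont: "continuous_on S (G k)" for S
    using G_deriv by (meson DERIV_isCont continuous_at_imp_continuous_on)
  have same: "G k 0 > 0 \<longleftrightarrow> G k y > 0" for y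
    using same_sign_if_no_zero[OF cont, of 0 y] same_sign_if_no_zero[OF cont, of y 0] no
    by (cases "0 \<le> y") auto
  define h where "h j = ln (K (real j * (of_int k * pi)))" for j :: nat
  have step: "h (Suc j) - h j = G k (real j * (of_int k * pi))" for j
    by (simp add: h_def G_def algebra_simps)
  have "K (real (2 * n) * (of_int k * pi)) = K 0"
    using K_shift[of 0 k] by (simp add: algebra_simps)
  then have per: "h (2 * n) = h 0" by (simp add: h_def)
  have pos: "0 < 2 * n" using n_pos by simp
  show False
  proof (cases "G k 0 > 0")
    case True
    then have "h j < h (Suc j)" for j using same[of "real j * (of_int k * pi)"] step[of j] by simp
    then have "h 0 < h (2 * n)" using pos by (rule lift_Suc_mono_less)
    then show False using per by simp
  next
    case False
    then have "G k (real j * (of_int k * pi)) < 0" for j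
      using same[of "real j * (of_int k * pi)"] no by (metis linorder_neqE_linordered_idom)
    then have "- h j < - h (Suc j)" for j using step[of j] by (metis diff_less_0_iff_less neg_less_iff_less)
    then have "- h 0 < - h (2 * n)" using pos by (rule lift_Suc_mono_less)
    then show False using per by simp
  qed
qed

lemma has_asymptote_iff: "has_asymptote f (B k) \<longleftrightarrow> even k"
proof
  assume "has_asymptote f (B k)"
  then obtain s t where "(ecirc s, ecirc t) \<in> B k" "ksum f s t = 0" unfolding has_asymptote_def by blast
  moreover then obtain m where "\<theta> t = \<theta> s + of_int m * pi" "in_branch k m" unfolding mem_B_iff by blast
  ultimately show "even k" using ksum_eq_0_iff in_branch_even_iff by blast
next
  assume "even k"
  obtain y where "G k y = 0" using G_has_zero by blast
  then have "ksum f (\<tau> y) (\<tau> (y + of_int k * pi)) = 0"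
    using ksum_eq_0_iff[of "\<tau> (y + of_int k * pi)" "\<tau> y" k] \<open>even k\<close> by simp
  moreover have "(ecirc (\<tau> y), ecirc (\<tau> (y + of_int k * pi))) \<in> B k"
    unfolding mem_B_iff theta_tau by (intro exI[of _ k]) (simp add: in_branch_def)
  ultimately show "has_asymptote f (B k)" unfolding has_asymptote_def by blast
qed

section \<open>Rotation numbers of the branches\<close>

definition chord :: "int \<Rightarrow> real \<Rightarrow> complex" where
  "chord m y = F (y + of_int m * pi) - F y"

lemma F_shift: "F (x + 2 * pi * n * of_int j) = F x"
  using periodic_int[of f 1, OF periodic] by (simp add: F_def tau_shift)

lemma continuous_F: "continuous_on S F"
  by (intro continuous_at_imp_continuous_on ballI has_vector_derivative_continuous[OF F_deriv])

lemma chord_quasiperiodic: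
  assumes "in_branch k m"
  shows "chord m (y + len k) = of_real (monodromy k) * chord m y"
proof (cases "k = int n")
  case True
  with assms obtain j where j: "m = int n + 2 * int n * j" using in_branch_n by blast
  have "F (y + pi * n + of_int m * pi) = F (y + 2 * pi * n * of_int (j + 1))"
    unfolding j by (simp add: algebra_simps)
  moreover have "F (y + of_int m * pi) = F (y + pi * n + 2 * pi * n * of_int j)"
    unfolding j by (simp add: algebra_simps)
  ultimately show ?thesis
    using True unfolding chord_def F_shift by (simp add: len_def monodromy_def)
next
  case False
  have "F (y + 2 * pi * n) = F y" "F (y + 2 * pi * n + of_int m * pi) = F (y + of_int m * pi)"
    using F_shift[of y 1] F_shift[of "y + of_int m * pi" 1] by (simp_all add: algebra_simps)
  then show ?thesis using False by (simp add: chord_def len_def monodromy_def)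
qed

text \<open>The chord never vanishes and stays tangent to the branch through cusps and asymptotes,
  so a quarter turn of its direction is a normal field. Conversely every lift stays orthogonal to
  the chord and so acquires the chord's sign \<open>monodromy k\<close>.\<close>

lemma normal_lift_exists_and_turn:
  assumes k: "k \<in> {1..int n}" and trav: "traversal f (B k) \<gamma>"
  shows "\<exists>\<phi>. normal_lift f \<gamma> \<phi>"
    and "normal_lift f \<gamma> \<phi> \<Longrightarrow> cos (\<phi> 1 - \<phi> 0) = monodromy k"
proof -
  obtain m where m: "in_branch k m"
    and par: "\<And>u. u \<in> {0..1} \<Longrightarrow> \<theta> (snd (\<gamma> u)) = \<theta> (fst (\<gamma> u)) + of_int m * pi"
    and der: "\<And>u. u \<in> {0..1} \<Longrightarrow> \<exists>c. c \<noteq> 0 \<and> ((\<lambda>v. \<theta> (fst (\<gamma> v))) has_real_derivative c) (at u)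
        \<and> ((\<lambda>v. \<theta> (snd (\<gamma> v))) has_real_derivative c) (at u)"
    and inj: "inj_on (\<lambda>u. \<theta> (fst (\<gamma> u))) {0..1}"
    and length: "\<bar>\<theta> (fst (\<gamma> 1)) - \<theta> (fst (\<gamma> 0))\<bar> = len k"
    using traversal_angle[OF k trav] by metis
  have nd: "\<not> 2 * int n dvd m" by (rule in_branch_not_dvd[OF k m])
  define X where "X u = \<theta> (fst (\<gamma> u))" for u
  define E where "E u = chord m (X u)" for u
  have contX: "continuous_on {0..1} X" unfolding X_def
    using der by (meson DERIV_isCont continuous_at_imp_continuous_on)
  have injX: "inj_on X {0..1}" using inj by (simp add: X_def[abs_def])
  have contE: "continuous_on {0..1} E" unfolding E_def chord_def
    by (intro continuous_intros continuous_on_compose2[OF continuous_F[of UNIV]] contX) auto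
  have E_nz: "E u \<noteq> 0" for u using F_neq[OF nd, of "X u"] by (simp add: E_def chord_def)
  have css: "\<exists>r. (G1 m (X u) \<noteq> 0 \<longrightarrow> r \<noteq> 0) \<and> D (\<lambda>v. css f (fst (\<gamma> v)) (snd (\<gamma> v))) u = r *\<^sub>R E u"
    if u: "u \<in> {0..1}" and ks: "ksum f (fst (\<gamma> u)) (snd (\<gamma> u)) \<noteq> 0" for u
  proof -
    obtain c where c: "c \<noteq> 0" "((\<lambda>v. \<theta> (fst (\<gamma> v))) has_real_derivative c) (at u)"
      "((\<lambda>v. \<theta> (snd (\<gamma> v))) has_real_derivative c) (at u)" using der[OF u] by blast
    obtain r where "r \<noteq> 0" "((\<lambda>v. css f (fst (\<gamma> v)) (snd (\<gamma> v))) has_vector_derivative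
        (r * c * G1 m (\<theta> (fst (\<gamma> u)))) *\<^sub>R (f (snd (\<gamma> u)) - f (fst (\<gamma> u)))) (at u)"
      using css_deriv[OF c(2,3) par[OF u] ks] by blast
    moreover have "E u = f (snd (\<gamma> u)) - f (fst (\<gamma> u))"
      by (simp add: E_def chord_def F_def X_def flip: par[OF u])
    ultimately show ?thesis using c(1)
      by (intro exI[of _ "r * c * G1 m (X u)"]) (auto dest: D_eqI simp: X_def)
  qed
  show "\<exists>\<phi>. normal_lift f \<gamma> \<phi>"
  proof -
    \<comment> \<open>The imaginary part of a continuous logarithm is an argument of the chord;
      adding \<open>pi / 2\<close> makes it normal.\<close>
    obtain g where g: "continuous_on {0..1} g" "\<And>u. u \<in> {0..1} \<Longrightarrow> E u = exp (g u)"
      using continuous_logarithm_on_contractible[OF contE convex_imp_contractible E_nz] by auto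
    have "normal_lift f \<gamma> (\<lambda>u. Im (g u) + pi / 2)"
      unfolding normal_lift_def
    proof (intro conjI ballI impI)
      show "continuous_on {0..1} (\<lambda>u. Im (g u) + pi / 2)" by (intro continuous_intros g(1))
      fix u :: real assume u: "u \<in> {0..1}" "ksum f (fst (\<gamma> u)) (snd (\<gamma> u)) \<noteq> 0"
      obtain r where r: "D (\<lambda>v. css f (fst (\<gamma> v)) (snd (\<gamma> v))) u = r *\<^sub>R E u" using css[OF u] by blast
      have "Re (cnj (cis (Im (g u) + pi / 2)) * E u) = 0"
        by (simp add: g(2)[OF u(1)] Re_exp Im_exp cos_add sin_add)
      then show "Re (cnj (cis (Im (g u) + pi / 2)) * D (\<lambda>v. css f (fst (\<gamma> v)) (snd (\<gamma> v))) u) = 0"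
        unfolding r mult_scaleR_right by simp
    qed
    then show ?thesis by blast
  qed
  show "cos (\<phi> 1 - \<phi> 0) = monodromy k" if lift: "normal_lift f \<gamma> \<phi>"
  proof -
    have cont\<phi>: "continuous_on {0..1} \<phi>" using lift by (simp add: normal_lift_def)
    \<comment> \<open>\<open>w\<close> is the chord seen in the frame of the normal; orthogonality
      means that it is purely imaginary.\<close>
    define w where "w u = cnj (cis (\<phi> u)) * E u" for u
    have contw: "continuous_on {0..1} w" unfolding w_def by (intro continuous_intros cont\<phi> contE)
    have w_nz: "w u \<noteq> 0" for u using E_nz[of u] by (simp add: w_def)
    \<comment> \<open>The lift says nothing where the branch point is infinite or the velocity
      vanishes. Those parameters map injectively into the zeros of \<open>G1\<close>, and of
      \<open>G\<close> for even \<open>m\<close>, on a bounded interval.\<close>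
    have "finite {u \<in> {0..1}. Re (w u) \<noteq> 0}"
    proof -
      obtain a where a: "X ` {0..1} \<subseteq> cbox (- a) a"
        using bounded_subset_cbox_symmetric[OF compact_imp_bounded[OF compact_continuous_image[OF contX compact_Icc]]] by blast
      let ?Z = "{y \<in> {-a..a}. G1 m y = 0} \<union> (if even m then {y \<in> {-a..a}. G m y = 0} else {})"
      have "finite ?Z"
        using simple_zeros_finite[OF G1_deriv G1_simple[OF nd]] simple_zeros_finite[OF G_deriv G_simple[OF nd]]
        by simp
      then have "finite (X -` ?Z \<inter> {0..1})" using injX by (rule finite_vimage_IntI)
      moreover have "{u \<in> {0..1}. Re (w u) \<noteq> 0} \<subseteq> X -` ?Z \<inter> {0..1}"
      proof
        fix u assume u: "u \<in> {u \<in> {0..1}. Re (w u) \<noteq> 0}"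
        have "G1 m (X u) = 0 \<or> ksum f (fst (\<gamma> u)) (snd (\<gamma> u)) = 0"
        proof (rule ccontr)
          assume no: "\<not> ?thesis"
          then obtain r where r: "r \<noteq> 0" "D (\<lambda>v. css f (fst (\<gamma> v)) (snd (\<gamma> v))) u = r *\<^sub>R E u"
            using css[of u] u by blast
          have "Re (cnj (cis (\<phi> u)) * D (\<lambda>v. css f (fst (\<gamma> v)) (snd (\<gamma> v))) u) = 0"
            using lift u no unfolding normal_lift_def by blast
          then have "r * Re (w u) = 0" unfolding r(2) mult_scaleR_right w_def by simp
          then show False using r(1) u by simp
        qed
        moreover have "X u \<in> {-a..a}" using a u unfolding cbox_interval by blast
        moreover have "u \<in> {0..1}" using u by blast
        ultimately show "u \<in> X -` ?Z \<inter> {0..1}"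
          using ksum_eq_0_iff[OF par[of u]] by (auto simp: X_def)
      qed
      ultimately show ?thesis by (rule finite_subset[rotated])
    qed
    then have Re0: "Re (w u) = 0" if "u \<in> {0..1}" for u
      by (intro continuous_eq_0_off_finite[of "\<lambda>u. Re (w u)"] that continuous_on_Re contw)
    have Im_nz: "Im (w u) \<noteq> 0" if "u \<in> {0..1}" for u
      using Re0[OF that] w_nz[of u] by (simp add: complex_eq_iff)
    have sign: "Im (w 0) > 0 \<longleftrightarrow> Im (w 1) > 0"
      by (rule same_sign_if_no_zero) (use contw Im_nz in \<open>auto intro!: continuous_intros\<close>)
    have E_w: "E u = cis (\<phi> u) * (\<i> * of_real (Im (w u)))" if "u \<in> {0..1}" for u
    proof -
      have "w u = \<i> * of_real (Im (w u))" using Re0[OF that] by (simp add: complex_eq_iff)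
      moreover have "E u = cis (\<phi> u) * w u" by (simp add: w_def cis_cnj cis_mult flip: mult.assoc)
      ultimately show ?thesis by simp
    qed
    have E10: "E 1 = of_real (monodromy k) * E 0"
    proof (cases "X 0 \<le> X 1")
      case True
      then have "X 1 = X 0 + len k" using length by (simp add: X_def)
      then show ?thesis by (simp add: E_def chord_quasiperiodic[OF m])
    next
      \<comment> \<open>A decreasing angle gives the inverse relation, but the sign
        \<open>monodromy k\<close> is its own inverse.\<close>
      case False
      then have "X 0 = X 1 + len k" using length by (simp add: X_def)
      then show ?thesis using monodromy_cases[of k] by (auto simp: E_def chord_quasiperiodic[OF m])
    qed
    \<comment> \<open>The end chords have equal length and the imaginary part of \<open>w\<close>
      keeps its sign, so \<open>w\<close> has the same value at both ends and the whole sign passes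
      to the normal.\<close>
    have "cmod (E 1) = cmod (E 0)" using E10 monodromy_cases[of k] by (auto simp: norm_mult)
    then have "\<bar>Im (w 1)\<bar> = \<bar>Im (w 0)\<bar>" by (simp add: E_w norm_mult)
    then have Im_eq: "Im (w 1) = Im (w 0)" using sign by linarith
    have "cis (\<phi> 1) * (\<i> * of_real (Im (w 0))) = of_real (monodromy k) * cis (\<phi> 0) * (\<i> * of_real (Im (w 0)))"
      using E10 E_w[of 0] E_w[of 1] Im_eq by (simp add: mult.assoc)
    then have "cis (\<phi> 1) = of_real (monodromy k) * cis (\<phi> 0)"
      using Im_nz[of 0] by simp
    then have "cis (\<phi> 1 - \<phi> 0) = of_real (monodromy k)"
      by (simp flip: cis_divide)
    then show ?thesis by (metis cis.sel(1) Re_complex_of_real)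
  qed
qed

lemma trav_traversal: "k \<in> {1..int n} \<Longrightarrow> traversal f (B k) (trav f (B k))"
  unfolding trav_def by (rule someI_ex[OF traversal_exists])

lemma cos_css_rot:
  assumes "k \<in> {1..int n}"
  shows "cos (2 * pi * css_rot f (B k)) = monodromy k"
proof -
  note t = trav_traversal[OF assms]
  define \<phi> where "\<phi> = (SOME \<phi>. normal_lift f (trav f (B k)) \<phi>)"
  have "normal_lift f (trav f (B k)) \<phi>"
    unfolding \<phi>_def by (rule someI_ex[OF normal_lift_exists_and_turn(1)[OF assms t]])
  from normal_lift_exists_and_turn(2)[OF assms t this] show ?thesis
    by (simp add: css_rot_def Let_def \<phi>_def)
qed

lemma css_rot_integer_iff:
  assumes "k \<in> {1..int n}"
  shows "css_rot f (B k) \<in> \<int> \<longleftrightarrow> k \<noteq> int n" and "css_rot f (B k) - 1/2 \<in> \<int> \<longleftrightarrow> k = int n"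
  using cos_2pi_eq_1_iff[of "css_rot f (B k)"] cos_2pi_eq_minus_1_iff[of "css_rot f (B k)"]
  unfolding cos_css_rot[OF assms] by (auto simp: monodromy_def split: if_splits)

end

theorem theorem4p18:
  fixes f :: "real \<Rightarrow> complex" and n :: nat
  assumes "generic_rosette f n"
  shows "card (branches f) = n
    \<and> card {B \<in> branches f. odd (css_cusp_count f B)} = 1
    \<and> card {B \<in> branches f. css_rot f B \<in> \<int>} = n - 1
    \<and> card {B \<in> branches f. css_rot f B - 1/2 \<in> \<int>} = 1
    \<and> card {B \<in> branches f. has_asymptote f B} = n div 2
    \<and> (\<forall>B \<in> branches f. \<not> has_asymptote f B \<longrightarrow> wc_cusp_count f B \<le> css_cusp_count f B)"
proof -
  obtain \<theta> \<tau> where "angle_param f n \<theta> \<tau>" using angle_param_exists[OF assms] by blast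
  then interpret angle_param f n \<theta> \<tau> .
  let ?I = "{1..int n}"
  have last: "{k \<in> ?I. k = int n} = {int n}" using n_pos by auto
  have init: "{k \<in> ?I. k \<noteq> int n} = {1..int n - 1}" by auto
  have "card (branches f) = n"
    by (simp add: branches_eq card_image[OF inj_on_B])
  moreover have "card {B \<in> branches f. odd (css_cusp_count f B)} = 1"
  proof -
    have "{k \<in> ?I. odd (css_cusp_count f (B k))} = {k \<in> ?I. k = int n}"
      using odd_css_cusps_iff trav_traversal unfolding css_cusp_count_def by blast
    then show ?thesis unfolding card_branches_filter last by simp
  qed
  moreover have "card {B \<in> branches f. css_rot f B \<in> \<int>} = n - 1"
  proof -
    have "{k \<in> ?I. css_rot f (B k) \<in> \<int>} = {k \<in> ?I. k \<noteq> int n}" using css_rot_integer_iff(1) by blast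
    then show ?thesis unfolding card_branches_filter init by simp
  qed
  moreover have "card {B \<in> branches f. css_rot f B - 1/2 \<in> \<int>} = 1"
  proof -
    have "{k \<in> ?I. css_rot f (B k) - 1/2 \<in> \<int>} = {k \<in> ?I. k = int n}" using css_rot_integer_iff(2) by blast
    then show ?thesis unfolding card_branches_filter last by simp
  qed
  moreover have "card {B \<in> branches f. has_asymptote f B} = n div 2"
    unfolding card_branches_filter has_asymptote_iff by (rule card_even_int_Icc)
  moreover have "\<forall>B \<in> branches f. \<not> has_asymptote f B \<longrightarrow> wc_cusp_count f B \<le> css_cusp_count f B"
    unfolding branches_eq wc_cusp_count_def css_cusp_count_def
    using has_asymptote_iff wc_cusps_le_css_cusps trav_traversal by blast
  ultimately show ?thesis by blast
qed

end
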